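(* Let $(B,X,\underline{*},\overline{*},* )$ be a shadow biquandle such that $X$ is strongly connected, and let $(X,\{\underline{\star}\},\{\overline{\star}\})$ be the corresponding local biquandle of $(B,X)$. Let $A$ be an abelian group. Then for any $n\in\mathbb{Z}$, $$H_n^{\rm SB}(B,X;A)\cong H_n^{\rm LB}(X;A)\quad\text{and}\quad H^n_{\rm SB}(B,X;A)\cong H^n_{\rm LB}(X;A).$$
   Context: A biquandle is a set $B$ with binary operations $\underline{*},\overline{*}:B\times B\to B$ such that: (i) $a\,\underline{*}\,a=a\,\overline{*}\,a$ for all $a\in B$; (ii) for every $b\in B$ the maps $B\to B$, $a\mapsto a\,\underline{*}\,b$ and $a\mapsto a\,\overline{*}\,b$ are bijective, and the map $S:B\times B\to B\times B$, $S(a,b)=(b\,\overline{*}\,a,\;a\,\underline{*}\,b)$ is bijective; (iii) for all $a,b,c\in B$: $(a\underline{*}b)\underline{*}(c\underline{*}b)=(a\underline{*}c)\underline{*}(b\overline{*}c)$, $(a\underline{*}b)\overline{*}(c\underline{*}b)=(a\overline{*}c)\underline{*}(b\overline{*}c)$, $(a\overline{*}b)\overline{*}(c\overline{*}b)=(a\overline{*}c)\overline{*}(b\underline{*}c)$. A $B$-set is a set $X$ with a map $*:X\times B\to X$ such that for each $a\in B$ the map $X\to X$, $x\mapsto x*a$ is bijective, and $(x*a)*(b\,\overline{*}\,a)=(x*b)*(a\,\underline{*}\,b)$ for all $a,b\in B$, $x\in X$. A shadow biquandle $(B,X,\underline{*},\overline{*},* )$ is a pair of a biquandle $B$ and a $B$-set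 $X$. A $B$-set $X$ is strongly connected if for every $x\in X$ the map $B\to X$, $a\mapsto x*a$ is bijective; then for $x,y\in X$, $x\searrow y\in B$ denotes the unique element $a\in B$ with $x*a=y$. A horizontal-tribracket on a set $X$ is a ternary operation $[\,]:X^3\to X$ such that: (H1) in the equation $[x,y,z]=w$, any three of $x,y,z,w$ that include $w$ determine the remaining one uniquely (and it exists); (H2) $[y,[x,y,z],[x,y,w]]=[z,[x,y,z],[x,z,w]]=[w,[x,y,w],[x,z,w]]$ for all $x,y,z,w\in X$. The local biquandle associated with $(X,[\,])$ consists of the operations, for each $x\in X$, $\underline{\star}_x,\overline{\star}_x:(\{x\}\times X)^2\to X^2$, $(x,y)\,\underline{\star}_x\,(x,z)=(z,[x,y,z])$, $(x,y)\,\overline{\star}_x\,(x,z)=(z,[x,z,y])$ (subscripts omitted). For a shadow biquandle $(B,X)$ with $X$ strongly connected, the corresponding horizontal-tribracket is $[x,y,z]=y*\big((x\searrow z)\overline{*}(x\searrow y)\big)=z*\big((x\searrow y)\underline{*}(x\searrow z)\big)$ (it is known that the two expressions agree and define a horizontal-tribracket), and the corresponding local biquandle of $(B,X)$ is the local biquandle associated with it. Shadow biquandle (co)homology: $C_n^{\rm sb}(B,X)$ is the free $\mathbb{Z}$-module on $X\times B^n$ if $n\ge 1$ and $0$ otherwise. The boundary is $$\partial_n^{\rm sb}(x,a_1,\dots,a_n)=\sum_{i=1}^n(-1)^i\big\{(x,a_1,\dots,a_{i-1},a_{i+1},\dots,a_n)-(x*a_i,a_1\underline{*}a_i,\dots,a_{i-1}\underline{*}a_i,a_{i+1}\overline{*}a_i,\dots,a_n\overline{*}a_i)\big\}$$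 for $n\ge 2$, and $\partial_n^{\rm sb}=0$ for $n\le 1$ (as $C_0^{\rm sb}=0$). $D_n^{\rm sb}(B,X)$ is the submodule generated by the $(x,a_1,\dots,a_n)$ with $a_i=a_{i+1}$ for some $i\in\{1,\dots,n-1\}$; these form a subcomplex, and $C_n^{\rm SB}(B,X)=C_n^{\rm sb}(B,X)/D_n^{\rm sb}(B,X)$ with induced boundary $\partial_n^{\rm SB}$. Local biquandle (co)homology: $C_n^{\rm lb}(X)$ is the free $\mathbb{Z}$-module on $\bigcup_{x\in X}(\{x\}\times X)^n=\{((x,y_1),\dots,(x,y_n)) : x,y_1,\dots,y_n\in X\}$ if $n\ge1$ and $0$ otherwise. The boundary is $$\partial_n^{\rm lb}\big((x,y_1),\dots,(x,y_n)\big)=\sum_{i=1}^n(-1)^i\big\{\big((x,y_1),\dots,(x,y_{i-1}),(x,y_{i+1}),\dots,(x,y_n)\big)-\big((x,y_1)\underline{\star}(x,y_i),\dots,(x,y_{i-1})\underline{\star}(x,y_i),(x,y_{i+1})\overline{\star}(x,y_i),\dots,(x,y_n)\overline{\star}(x,y_i)\big)\big\}$$ for $n\ge2$, and $\partial_n^{\rm lb}=0$ otherwise. $D_n^{\rm lb}(X)$ is the submodule generated by the $((x,y_1),\dots,(x,y_n))$ with $y_i=y_{i+1}$ for some $i\in\{1,\dots,n-1\}$; these form a subcomplex, and $C_n^{\rm LB}(X)=C_n^{\rm lb}(X)/D_n^{\rm lb}(X)$ with induced boundary $\partial_n^{\rm LB}$. For an abelian group $A$, $H_n^{\rm SB}(B,X;A)$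 and $H_n^{\rm LB}(X;A)$ are the homology groups of $C_*^{\rm SB}(B,X)\otimes A$ and $C_*^{\rm LB}(X)\otimes A$ (boundary $\partial\otimes{\rm id}$), and $H^n_{\rm SB}(B,X;A)$ and $H^n_{\rm LB}(X;A)$ are the cohomology groups of ${\rm Hom}(C_*^{\rm SB}(B,X),A)$ and ${\rm Hom}(C_*^{\rm LB}(X),A)$, with $\delta^n(f)=f\circ\partial_{n+1}$. *)

theory Defs
  imports "HOL-Algebra.Free_Abelian_Groups"
begin

section \<open>Shadow biquandles\<close>

text \<open>Closure of \<open>B\<close> under the operations is part of the bijectivity conditions.\<close>

locale biquandle =
  fixes B :: "'b set"
    and under_op :: "'b \<Rightarrow> 'b \<Rightarrow> 'b" (infixl "\<triangleleft>" 70)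
    and over_op :: "'b \<Rightarrow> 'b \<Rightarrow> 'b" (infixl "\<triangleright>" 70)
  assumes diag: "a \<in> B \<Longrightarrow> a \<triangleleft> a = a \<triangleright> a"
    and bij_under: "b \<in> B \<Longrightarrow> bij_betw (\<lambda>a. a \<triangleleft> b) B B"
    and bij_over: "b \<in> B \<Longrightarrow> bij_betw (\<lambda>a. a \<triangleright> b) B B"
    and bij_switch: "bij_betw (\<lambda>(a, b). (b \<triangleright> a, a \<triangleleft> b)) (B \<times> B) (B \<times> B)"
    and exchange1: "\<lbrakk>a \<in> B; b \<in> B; c \<in> B\<rbrakk> \<Longrightarrow>
          (a \<triangleleft> b) \<triangleleft> (c \<triangleleft> b) = (a \<triangleleft> c) \<triangleleft> (b \<triangleright> c)"
    and exchange2: "\<lbrakk>a \<in> B; b \<in> B; c \<in> B\<rbrakk> \<Longrightarrow>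
          (a \<triangleleft> b) \<triangleright> (c \<triangleleft> b) = (a \<triangleright> c) \<triangleleft> (b \<triangleright> c)"
    and exchange3: "\<lbrakk>a \<in> B; b \<in> B; c \<in> B\<rbrakk> \<Longrightarrow>
          (a \<triangleright> b) \<triangleright> (c \<triangleright> b) = (a \<triangleright> c) \<triangleright> (b \<triangleleft> c)"

locale shadow_biquandle = biquandle +
  fixes X :: "'x set"
    and act :: "'x \<Rightarrow> 'b \<Rightarrow> 'x" (infixl "\<diamondop>" 70)
  assumes bij_act: "a \<in> B \<Longrightarrow> bij_betw (\<lambda>x. x \<diamondop> a) X X"
    and act_act: "\<lbrakk>a \<in> B; b \<in> B; x \<in> X\<rbrakk> \<Longrightarrow>
          (x \<diamondop> a) \<diamondop> (b \<triangleright> a) = (x \<diamondop> b) \<diamondop> (a \<triangleleft> b)"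

definition strongly_connected :: "'b set \<Rightarrow> 'x set \<Rightarrow> ('x \<Rightarrow> 'b \<Rightarrow> 'x) \<Rightarrow> bool" where
  "strongly_connected B X act \<longleftrightarrow> (\<forall>x\<in>X. bij_betw (act x) B X)"

definition connector :: "'b set \<Rightarrow> ('x \<Rightarrow> 'b \<Rightarrow> 'x) \<Rightarrow> 'x \<Rightarrow> 'x \<Rightarrow> 'b" where
  "connector B act x y = (THE a. a \<in> B \<and> act x a = y)"


section \<open>Horizontal tribrackets and local biquandles\<close>

locale horizontal_tribracket =
  fixes X :: "'x set"
    and t :: "'x \<Rightarrow> 'x \<Rightarrow> 'x \<Rightarrow> 'x"
  assumes closed: "\<lbrakk>x \<in> X; y \<in> X; z \<in> X\<rbrakk> \<Longrightarrow> t x y z \<in> X"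
    and unique_left: "\<lbrakk>y \<in> X; z \<in> X; w \<in> X\<rbrakk> \<Longrightarrow> \<exists>!x. x \<in> X \<and> t x y z = w"
    and unique_middle: "\<lbrakk>x \<in> X; z \<in> X; w \<in> X\<rbrakk> \<Longrightarrow> \<exists>!y. y \<in> X \<and> t x y z = w"
    and unique_right: "\<lbrakk>x \<in> X; y \<in> X; w \<in> X\<rbrakk> \<Longrightarrow> \<exists>!z. z \<in> X \<and> t x y z = w"
    and bracket1: "\<lbrakk>x \<in> X; y \<in> X; z \<in> X; w \<in> X\<rbrakk> \<Longrightarrow>
          t y (t x y z) (t x y w) = t z (t x y z) (t x z w)"
    and bracket2: "\<lbrakk>x \<in> X; y \<in> X; z \<in> X; w \<in> X\<rbrakk> \<Longrightarrow>
          t z (t x y z) (t x z w) = t w (t x y w) (t x z w)"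

text \<open>
  The operations of the local biquandle are only meaningful on pairs with equal first
  component \<open>x\<close>; the family over all \<open>x\<close> is represented by one function on pairs.
\<close>

definition local_under :: "('x \<Rightarrow> 'x \<Rightarrow> 'x \<Rightarrow> 'x) \<Rightarrow> 'x \<times> 'x \<Rightarrow> 'x \<times> 'x \<Rightarrow> 'x \<times> 'x" where
  "local_under t p q = (snd q, t (fst p) (snd p) (snd q))"

definition local_over :: "('x \<Rightarrow> 'x \<Rightarrow> 'x \<Rightarrow> 'x) \<Rightarrow> 'x \<times> 'x \<Rightarrow> 'x \<times> 'x \<Rightarrow> 'x \<times> 'x" where
  "local_over t p q = (snd q, t (fst p) (snd q) (snd p))"

definition shadow_tribracket ::
    "'b set \<Rightarrow> ('b \<Rightarrow> 'b \<Rightarrow> 'b) \<Rightarrow> ('x \<Rightarrow> 'b \<Rightarrow> 'x) \<Rightarrow> 'x \<Rightarrow> 'x \<Rightarrow> 'x \<Rightarrow> 'x" where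
  "shadow_tribracket B over_op act x y z = act y (over_op (connector B act x z) (connector B act x y))"

context shadow_biquandle
begin

lemma under_closed: "a \<in> B \<Longrightarrow> b \<in> B \<Longrightarrow> a \<triangleleft> b \<in> B"
  using bij_under bij_betwE by blast

lemma over_closed: "a \<in> B \<Longrightarrow> b \<in> B \<Longrightarrow> a \<triangleright> b \<in> B"
  using bij_over bij_betwE by blast

lemma act_closed: "x \<in> X \<Longrightarrow> a \<in> B \<Longrightarrow> x \<diamondop> a \<in> X"
  using bij_act bij_betwE by blast

context
  assumes sc: "strongly_connected B X (\<diamondop>)"
begin

lemma connector_act: "x \<in> X \<Longrightarrow> a \<in> B \<Longrightarrow> connector B (\<diamondop>) x (x \<diamondop> a) = a"
  using sc unfolding connector_def strongly_connected_def bij_betw_def inj_on_def by blast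

lemma act_cancel: "\<lbrakk>x \<diamondop> a = x \<diamondop> b; x \<in> X; a \<in> B; b \<in> B\<rbrakk> \<Longrightarrow> a = b"
  by (metis connector_act)

lemma ex_connector: "x \<in> X \<Longrightarrow> y \<in> X \<Longrightarrow> \<exists>a\<in>B. y = x \<diamondop> a"
  using sc unfolding strongly_connected_def bij_betw_def by blast

lemma shadow_tribracket_act:
  "\<lbrakk>x \<in> X; a \<in> B; b \<in> B\<rbrakk> \<Longrightarrow>
    shadow_tribracket B (\<triangleright>) (\<diamondop>) x (x \<diamondop> a) (x \<diamondop> b) = (x \<diamondop> a) \<diamondop> (b \<triangleright> a)"
  by (simp add: shadow_tribracket_def connector_act)

lemma shadow_tribracket_act':
  "\<lbrakk>x \<in> X; a \<in> B; b \<in> B\<rbrakk> \<Longrightarrow>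
    shadow_tribracket B (\<triangleright>) (\<diamondop>) x (x \<diamondop> a) (x \<diamondop> b) = (x \<diamondop> b) \<diamondop> (a \<triangleleft> b)"
  by (simp add: shadow_tribracket_act act_act)

lemma shadow_tribracket_alt:
  assumes "x \<in> X" "y \<in> X" "z \<in> X"
  shows "shadow_tribracket B (\<triangleright>) (\<diamondop>) x y z =
    z \<diamondop> (connector B (\<diamondop>) x y \<triangleleft> connector B (\<diamondop>) x z)"
  using ex_connector[OF assms(1,2)] ex_connector[OF assms(1,3)] assms(1)
  by (auto simp: shadow_tribracket_act' connector_act)

lemma horizontal_tribracket_shadow:
  "horizontal_tribracket X (shadow_tribracket B (\<triangleright>) (\<diamondop>))" (is "horizontal_tribracket X ?t")
proof
  fix x y z
  assume "x \<in> X" "y \<in> X" "z \<in> X"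
  with ex_connector show "?t x y z \<in> X"
    by (metis shadow_tribracket_act act_closed over_closed)
next
  fix y z w
  assume X: "y \<in> X" "z \<in> X" "w \<in> X"
  obtain c d where cd: "c \<in> B" "w = y \<diamondop> c" "d \<in> B" "w = z \<diamondop> d"
    using ex_connector[OF X(1,3)] ex_connector[OF X(2,3)] by blast
  have "(c, d) \<in> (\<lambda>(a, b). (b \<triangleright> a, a \<triangleleft> b)) ` (B \<times> B)"
    using bij_betw_imp_surj_on[OF bij_switch] cd(1,3) by simp
  then obtain a b where ab: "a \<in> B" "b \<in> B" "c = b \<triangleright> a" "d = a \<triangleleft> b"
    by auto
  have "y \<in> (\<lambda>x. x \<diamondop> a) ` X"
    using bij_betw_imp_surj_on[OF bij_act[OF ab(1)]] X(1) by simp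
  then obtain x where x: "x \<in> X" "x \<diamondop> a = y"
    by blast
  have "(x \<diamondop> b) \<diamondop> d = z \<diamondop> d"
    using act_act[OF ab(1,2) x(1)] unfolding x(2) ab(3,4)[symmetric] cd(2)[symmetric] cd(4) by simp
  then have xz: "x \<diamondop> b = z"
    by (rule inj_onD[OF bij_betw_imp_inj_on[OF bij_act[OF cd(3)]]])
      (use act_closed[OF x(1) ab(2)] X(2) in auto)
  show "\<exists>!x. x \<in> X \<and> ?t x y z = w"
  proof (intro ex1I conjI)
    show "x \<in> X" by fact
    show "?t x y z = w"
      using shadow_tribracket_act[OF x(1) ab(1,2)] x(2) xz ab(3) cd(2) by simp
  next
    fix x'
    assume x': "x' \<in> X \<and> ?t x' y z = w"
    obtain a' b' where ab': "a' \<in> B" "y = x' \<diamondop> a'" "b' \<in> B" "z = x' \<diamondop> b'"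
      using ex_connector[of x' y] ex_connector[of x' z] x' X(1,2) by blast
    have "y \<diamondop> (b' \<triangleright> a') = y \<diamondop> c"
      using shadow_tribracket_act[OF conjunct1[OF x'] ab'(1,3)] x' by (simp flip: ab'(2,4) cd(2))
    then have 1: "b' \<triangleright> a' = c"
      using X(1) over_closed[OF ab'(3,1)] cd(1) by (rule act_cancel)
    have "z \<diamondop> (a' \<triangleleft> b') = z \<diamondop> d"
      using shadow_tribracket_act'[OF conjunct1[OF x'] ab'(1,3)] x' by (simp flip: ab'(2,4) cd(4))
    then have 2: "a' \<triangleleft> b' = d"
      using X(2) under_closed[OF ab'(1,3)] cd(3) by (rule act_cancel)
    have "(a', b') = (a, b)"
      by (rule inj_onD[OF bij_betw_imp_inj_on[OF bij_switch]])
        (simp_all add: 1 2 ab(1,2) ab'(1,3) flip: ab(3,4))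
    then show "x' = x"
      using inj_onD[OF bij_betw_imp_inj_on[OF bij_act[OF ab(1)]], of x' x] x x' ab'(2) by simp
  qed
next
  fix x z w
  assume X: "x \<in> X" "z \<in> X" "w \<in> X"
  obtain b where b: "b \<in> B" "z = x \<diamondop> b" using ex_connector[OF X(1,2)] by blast
  obtain c where c: "c \<in> B" "w = z \<diamondop> c" using ex_connector[OF X(2,3)] by blast
  have "c \<in> (\<lambda>a. a \<triangleleft> b) ` B"
    using bij_betw_imp_surj_on[OF bij_under[OF b(1)]] c(1) by simp
  then obtain a where a: "a \<in> B" "a \<triangleleft> b = c"
    by blast
  show "\<exists>!y. y \<in> X \<and> ?t x y z = w"
  proof (intro ex1I conjI)
    show "x \<diamondop> a \<in> X" using X a act_closed by blast
    show "?t x (x \<diamondop> a) z = w"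
      using shadow_tribracket_act'[OF X(1) a(1) b(1)] a b c by simp
  next
    fix y
    assume y: "y \<in> X \<and> ?t x y z = w"
    obtain a' where a': "a' \<in> B" "y = x \<diamondop> a'" using ex_connector[of x y] X(1) y by blast
    have "z \<diamondop> (a' \<triangleleft> b) = z \<diamondop> c"
      using shadow_tribracket_act'[OF X(1) a'(1) b(1)] y a' b c by simp
    then have "a' \<triangleleft> b = c"
      using X(2) under_closed[OF a'(1) b(1)] c(1) by (rule act_cancel)
    then show "y = x \<diamondop> a"
      using inj_onD[OF bij_betw_imp_inj_on[OF bij_under[OF b(1)]], of a' a] a a' by simp
  qed
next
  fix x y w
  assume X: "x \<in> X" "y \<in> X" "w \<in> X"
  obtain a where a: "a \<in> B" "y = x \<diamondop> a" using ex_connector[OF X(1,2)] by blast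
  obtain c where c: "c \<in> B" "w = y \<diamondop> c" using ex_connector[OF X(2,3)] by blast
  have "c \<in> (\<lambda>b. b \<triangleright> a) ` B"
    using bij_betw_imp_surj_on[OF bij_over[OF a(1)]] c(1) by simp
  then obtain b where b: "b \<in> B" "b \<triangleright> a = c"
    by blast
  show "\<exists>!z. z \<in> X \<and> ?t x y z = w"
  proof (intro ex1I conjI)
    show "x \<diamondop> b \<in> X" using X b act_closed by blast
    show "?t x y (x \<diamondop> b) = w"
      using shadow_tribracket_act[OF X(1) a(1) b(1)] a b c by simp
  next
    fix z
    assume z: "z \<in> X \<and> ?t x y z = w"
    obtain b' where b': "b' \<in> B" "z = x \<diamondop> b'" using ex_connector[of x z] X(1) z by blast
    have "y \<diamondop> (b' \<triangleright> a) = y \<diamondop> c"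
      using shadow_tribracket_act[OF X(1) a(1) b'(1)] z a b' c by simp
    then have "b' \<triangleright> a = c"
      using X(2) over_closed[OF b'(1) a(1)] c(1) by (rule act_cancel)
    then show "z = x \<diamondop> b"
      using inj_onD[OF bij_betw_imp_inj_on[OF bij_over[OF a(1)]], of b' b] b b' by simp
  qed
next
  fix x y z w
  assume X: "x \<in> X" "y \<in> X" "z \<in> X" "w \<in> X"
  obtain a b c where abc: "a \<in> B" "y = x \<diamondop> a" "b \<in> B" "z = x \<diamondop> b" "c \<in> B" "w = x \<diamondop> c"
    using ex_connector[OF X(1,2)] ex_connector[OF X(1,3)] ex_connector[OF X(1,4)] by blast
  have xyz: "?t x y z = y \<diamondop> (b \<triangleright> a)" "?t x y z = z \<diamondop> (a \<triangleleft> b)"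
    and xyw: "?t x y w = y \<diamondop> (c \<triangleright> a)" "?t x y w = w \<diamondop> (a \<triangleleft> c)"
    and xzw: "?t x z w = z \<diamondop> (c \<triangleright> b)" "?t x z w = w \<diamondop> (b \<triangleleft> c)"
    using X abc shadow_tribracket_act shadow_tribracket_act' by auto
  have l: "?t y (?t x y z) (?t x y w) = ?t x y z \<diamondop> ((c \<triangleright> a) \<triangleright> (b \<triangleright> a))"
    using shadow_tribracket_act[OF X(2), of "b \<triangleright> a" "c \<triangleright> a"] xyz(1) xyw(1) abc over_closed by simp
  have m: "?t z (?t x y z) (?t x z w) = ?t x y z \<diamondop> ((c \<triangleright> b) \<triangleright> (a \<triangleleft> b))"
    using shadow_tribracket_act[OF X(3), of "a \<triangleleft> b" "c \<triangleright> b"] xyz(2) xzw(1) abc over_closed under_closed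
    by simp
  have m': "?t z (?t x y z) (?t x z w) = ?t x z w \<diamondop> ((a \<triangleleft> b) \<triangleleft> (c \<triangleright> b))"
    using shadow_tribracket_act'[OF X(3), of "a \<triangleleft> b" "c \<triangleright> b"] xyz(2) xzw(1) abc over_closed under_closed
    by simp
  have r: "?t w (?t x y w) (?t x z w) = ?t x z w \<diamondop> ((a \<triangleleft> c) \<triangleleft> (b \<triangleleft> c))"
    using shadow_tribracket_act'[OF X(4), of "a \<triangleleft> c" "b \<triangleleft> c"] xyw(2) xzw(2) abc under_closed by simp
  show "?t y (?t x y z) (?t x y w) = ?t z (?t x y z) (?t x z w)"
    using l m exchange3[of c a b] abc by simp
  show "?t z (?t x y z) (?t x z w) = ?t w (?t x y w) (?t x z w)"
    using m' r exchange1[of a c b] abc by simp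
qed

end

end


section \<open>Complexes of abelian groups and their (co)homology\<close>

text \<open>
  A complex is a family \<open>C\<close> of abelian groups indexed by the integers, with maps \<open>d n\<close> from
  \<open>C n\<close> to \<open>C (n - 1)\<close>. Groups are written multiplicatively, as everywhere in \<open>HOL-Algebra\<close>.
\<close>

text \<open>
  The map \<open>G Mod N \<rightarrow> H Mod M\<close> induced by \<open>h\<close>: if \<open>h\<close> maps \<open>N\<close> into \<open>M\<close>, all elements of a coset
  of \<open>N\<close> give the same coset of \<open>M\<close>, and this coset is the value.
\<close>

definition induced_map ::
    "('h, 'm) monoid_scheme \<Rightarrow> 'h set \<Rightarrow> ('g \<Rightarrow> 'h) \<Rightarrow> 'g set \<Rightarrow> 'h set" where
  "induced_map H M h K = the_elem ((\<lambda>c. M #>\<^bsub>H\<^esub> h c) ` K)"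

lemma induced_map_coset:
  assumes G: "group G" and H: "group H" and h: "h \<in> hom G H"
    and N: "subgroup N G" and M: "subgroup M H" and hN: "h ` N \<subseteq> M"
    and c: "c \<in> carrier G"
  shows "induced_map H M h (N #>\<^bsub>G\<^esub> c) = M #>\<^bsub>H\<^esub> h c"
proof -
  interpret G: group G by fact
  interpret H: group H by fact
  have "M #>\<^bsub>H\<^esub> h (k \<otimes>\<^bsub>G\<^esub> c) = M #>\<^bsub>H\<^esub> h c" if "k \<in> N" for k
  proof -
    have "k \<in> carrier G" "h k \<in> M" "h k \<in> carrier H" "h c \<in> carrier H"
      using that hN N M h c subgroup.mem_carrier by (fastforce simp: hom_def)+
    then show ?thesis
      using hom_mult[OF h _ c] H.coset_mult_assoc[of M "h k" "h c"] M
      by (simp add: H.coset_join2 subgroup.subset)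
  qed
  then have "(\<lambda>c. M #>\<^bsub>H\<^esub> h c) ` (N #>\<^bsub>G\<^esub> c) = {M #>\<^bsub>H\<^esub> h c}"
    using G.rcos_self[OF c N] by (auto simp: r_coset_def[of G])
  then show ?thesis
    by (simp add: induced_map_def)
qed

definition tensor_relations ::
    "('g, 'm) monoid_scheme \<Rightarrow> ('a, 'k) monoid_scheme \<Rightarrow> ('g \<times> 'a \<Rightarrow>\<^sub>0 int) set" where
  "tensor_relations G A = generate (free_Abelian_group (carrier G \<times> carrier A))
     ({frag_of (g \<otimes>\<^bsub>G\<^esub> g', a) - frag_of (g, a) - frag_of (g', a) | g g' a.
         g \<in> carrier G \<and> g' \<in> carrier G \<and> a \<in> carrier A} \<union>
      {frag_of (g, a \<otimes>\<^bsub>A\<^esub> a') - frag_of (g, a) - frag_of (g, a') | g a a'.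
         g \<in> carrier G \<and> a \<in> carrier A \<and> a' \<in> carrier A})"

definition tensor_group ::
    "('g, 'm) monoid_scheme \<Rightarrow> ('a, 'k) monoid_scheme \<Rightarrow> ('g \<times> 'a \<Rightarrow>\<^sub>0 int) set monoid" where
  "tensor_group G A = free_Abelian_group (carrier G \<times> carrier A) Mod tensor_relations G A"

text \<open>The map from \<open>tensor_group G A\<close> to \<open>tensor_group H A\<close> given by \<open>h \<otimes> id\<close>.\<close>

definition tensor_map ::
    "('h, 'm) monoid_scheme \<Rightarrow> ('a, 'k) monoid_scheme \<Rightarrow> ('g \<Rightarrow> 'h) \<Rightarrow>
     ('g \<times> 'a \<Rightarrow>\<^sub>0 int) set \<Rightarrow> ('h \<times> 'a \<Rightarrow>\<^sub>0 int) set" where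
  "tensor_map H A h = induced_map (free_Abelian_group (carrier H \<times> carrier A))
     (tensor_relations H A) (frag_extend (\<lambda>(g, a). frag_of (h g, a)))"

text \<open>
  Homomorphisms are restricted to the carrier of their domain, so that equality of elements of
  the group is equality of homomorphisms.
\<close>

definition hom_group ::
    "('g, 'm) monoid_scheme \<Rightarrow> ('a, 'k) monoid_scheme \<Rightarrow> ('g \<Rightarrow> 'a) monoid" where
  "hom_group G A =
     \<lparr>carrier = hom G A \<inter> extensional (carrier G),
      monoid.mult = (\<lambda>f g. \<lambda>x\<in>carrier G. f x \<otimes>\<^bsub>A\<^esub> g x),
      one = (\<lambda>x\<in>carrier G. \<one>\<^bsub>A\<^esub>)\<rparr>"

definition subquotient ::
    "('g, 'm) monoid_scheme \<Rightarrow> ('h, 'k) monoid_scheme \<Rightarrow> ('g \<Rightarrow> 'h) \<Rightarrow> 'g set \<Rightarrow> 'g set monoid" where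
  "subquotient G H h I = (G\<lparr>carrier := kernel G H h\<rparr>) Mod I"

definition homology ::
    "(int \<Rightarrow> 'c monoid) \<Rightarrow> (int \<Rightarrow> 'c \<Rightarrow> 'c) \<Rightarrow> int \<Rightarrow> 'c set monoid" where
  "homology C d n =
     subquotient (C n) (C (n - 1)) (d n) (d (n + 1) ` carrier (C (n + 1)))"

definition cohomology ::
    "(int \<Rightarrow> 'c monoid) \<Rightarrow> (int \<Rightarrow> 'c \<Rightarrow> 'c) \<Rightarrow> int \<Rightarrow> 'c set monoid" where
  "cohomology C \<delta> n =
     subquotient (C n) (C (n + 1)) (\<delta> n) (\<delta> (n - 1) ` carrier (C (n - 1)))"

definition homology_coeff ::
    "(int \<Rightarrow> 'c monoid) \<Rightarrow> (int \<Rightarrow> 'c \<Rightarrow> 'c) \<Rightarrow> 'a monoid \<Rightarrow> int \<Rightarrow>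
     ('c \<times> 'a \<Rightarrow>\<^sub>0 int) set set monoid" where
  "homology_coeff C d A =
     homology (\<lambda>n. tensor_group (C n) A) (\<lambda>n. tensor_map (C (n - 1)) A (d n))"

definition cohomology_coeff ::
    "(int \<Rightarrow> 'c monoid) \<Rightarrow> (int \<Rightarrow> 'c \<Rightarrow> 'c) \<Rightarrow> 'a monoid \<Rightarrow> int \<Rightarrow> ('c \<Rightarrow> 'a) set monoid" where
  "cohomology_coeff C d A =
     cohomology (\<lambda>n. hom_group (C n) A) (\<lambda>n f. compose (carrier (C (n + 1))) f (d (n + 1)))"


section \<open>The shadow biquandle complex\<close>

text \<open>
  The tuple \<open>(x, a\<^sub>1, \<dots>, a\<^sub>n)\<close> is represented by \<open>(x, [a\<^sub>1, \<dots>, a\<^sub>n])\<close>; list positions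
  start at 0, so \<open>a\<^sub>i\<close> is \<open>as ! (i - 1)\<close>.
\<close>

definition sb_basis :: "'b set \<Rightarrow> 'x set \<Rightarrow> int \<Rightarrow> ('x \<times> 'b list) set" where
  "sb_basis B X n = {(x, as). x \<in> X \<and> set as \<subseteq> B \<and> int (length as) = n \<and> n \<ge> 1}"

definition sb_chain :: "'b set \<Rightarrow> 'x set \<Rightarrow> int \<Rightarrow> ('x \<times> 'b list \<Rightarrow>\<^sub>0 int) monoid" where
  "sb_chain B X n = free_Abelian_group (sb_basis B X n)"

definition sb_boundary ::
    "('b \<Rightarrow> 'b \<Rightarrow> 'b) \<Rightarrow> ('b \<Rightarrow> 'b \<Rightarrow> 'b) \<Rightarrow> ('x \<Rightarrow> 'b \<Rightarrow> 'x) \<Rightarrow> int \<Rightarrow>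
     ('x \<times> 'b list \<Rightarrow>\<^sub>0 int) \<Rightarrow> ('x \<times> 'b list \<Rightarrow>\<^sub>0 int)" where
  "sb_boundary under_op over_op act n c =
     (if n \<ge> 2 then
        frag_extend (\<lambda>(x, as). \<Sum>i = 1..length as. frag_cmul ((-1) ^ i)
          (frag_of (x, take (i - 1) as @ drop i as) -
           frag_of (act x (as ! (i - 1)),
             map (\<lambda>a. under_op a (as ! (i - 1))) (take (i - 1) as) @
             map (\<lambda>a. over_op a (as ! (i - 1))) (drop i as)))) c
      else 0)"

definition sb_degenerate :: "'b set \<Rightarrow> 'x set \<Rightarrow> int \<Rightarrow> ('x \<times> 'b list \<Rightarrow>\<^sub>0 int) set" where
  "sb_degenerate B X n = generate (sb_chain B X n)
     (frag_of ` {(x, as) \<in> sb_basis B X n.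
        \<exists>i. 1 \<le> i \<and> i \<le> length as - 1 \<and> as ! (i - 1) = as ! i})"

definition SB_chain :: "'b set \<Rightarrow> 'x set \<Rightarrow> int \<Rightarrow> ('x \<times> 'b list \<Rightarrow>\<^sub>0 int) set monoid" where
  "SB_chain B X n = sb_chain B X n Mod sb_degenerate B X n"

definition SB_boundary ::
    "'b set \<Rightarrow> ('b \<Rightarrow> 'b \<Rightarrow> 'b) \<Rightarrow> ('b \<Rightarrow> 'b \<Rightarrow> 'b) \<Rightarrow> 'x set \<Rightarrow> ('x \<Rightarrow> 'b \<Rightarrow> 'x) \<Rightarrow> int \<Rightarrow>
     ('x \<times> 'b list \<Rightarrow>\<^sub>0 int) set \<Rightarrow> ('x \<times> 'b list \<Rightarrow>\<^sub>0 int) set" where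
  "SB_boundary B under_op over_op X act n =
     induced_map (sb_chain B X (n - 1)) (sb_degenerate B X (n - 1)) (sb_boundary under_op over_op act n)"

definition SB_homology ::
    "'b set \<Rightarrow> ('b \<Rightarrow> 'b \<Rightarrow> 'b) \<Rightarrow> ('b \<Rightarrow> 'b \<Rightarrow> 'b) \<Rightarrow> 'x set \<Rightarrow> ('x \<Rightarrow> 'b \<Rightarrow> 'x) \<Rightarrow> 'a monoid \<Rightarrow>
     int \<Rightarrow> (('x \<times> 'b list \<Rightarrow>\<^sub>0 int) set \<times> 'a \<Rightarrow>\<^sub>0 int) set set monoid" where
  "SB_homology B under_op over_op X act =
     homology_coeff (SB_chain B X) (SB_boundary B under_op over_op X act)"

definition SB_cohomology ::
    "'b set \<Rightarrow> ('b \<Rightarrow> 'b \<Rightarrow> 'b) \<Rightarrow> ('b \<Rightarrow> 'b \<Rightarrow> 'b) \<Rightarrow> 'x set \<Rightarrow> ('x \<Rightarrow> 'b \<Rightarrow> 'x) \<Rightarrow> 'a monoid \<Rightarrow>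
     int \<Rightarrow> (('x \<times> 'b list \<Rightarrow>\<^sub>0 int) set \<Rightarrow> 'a) set monoid" where
  "SB_cohomology B under_op over_op X act =
     cohomology_coeff (SB_chain B X) (SB_boundary B under_op over_op X act)"


section \<open>The local biquandle complex\<close>

definition lb_basis :: "'x set \<Rightarrow> int \<Rightarrow> ('x \<times> 'x) list set" where
  "lb_basis X n = (\<Union>x\<in>X. {ps. set ps \<subseteq> {x} \<times> X \<and> int (length ps) = n \<and> n \<ge> 1})"

definition lb_chain :: "'x set \<Rightarrow> int \<Rightarrow> (('x \<times> 'x) list \<Rightarrow>\<^sub>0 int) monoid" where
  "lb_chain X n = free_Abelian_group (lb_basis X n)"

definition lb_boundary ::
    "('x \<Rightarrow> 'x \<Rightarrow> 'x \<Rightarrow> 'x) \<Rightarrow> int \<Rightarrow>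
     (('x \<times> 'x) list \<Rightarrow>\<^sub>0 int) \<Rightarrow> (('x \<times> 'x) list \<Rightarrow>\<^sub>0 int)" where
  "lb_boundary t n c =
     (if n \<ge> 2 then
        frag_extend (\<lambda>ps. \<Sum>i = 1..length ps. frag_cmul ((-1) ^ i)
          (frag_of (take (i - 1) ps @ drop i ps) -
           frag_of
            (map (\<lambda>p. local_under t p (ps ! (i - 1))) (take (i - 1) ps) @
             map (\<lambda>p. local_over t p (ps ! (i - 1))) (drop i ps)))) c
      else 0)"

definition lb_degenerate :: "'x set \<Rightarrow> int \<Rightarrow> (('x \<times> 'x) list \<Rightarrow>\<^sub>0 int) set" where
  "lb_degenerate X n = generate (lb_chain X n)
     (frag_of ` {ps \<in> lb_basis X n.
        \<exists>i. 1 \<le> i \<and> i \<le> length ps - 1 \<and> ps ! (i - 1) = ps ! i})"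

definition LB_chain :: "'x set \<Rightarrow> int \<Rightarrow> (('x \<times> 'x) list \<Rightarrow>\<^sub>0 int) set monoid" where
  "LB_chain X n = lb_chain X n Mod lb_degenerate X n"

definition LB_boundary ::
    "'x set \<Rightarrow> ('x \<Rightarrow> 'x \<Rightarrow> 'x \<Rightarrow> 'x) \<Rightarrow> int \<Rightarrow>
     (('x \<times> 'x) list \<Rightarrow>\<^sub>0 int) set \<Rightarrow> (('x \<times> 'x) list \<Rightarrow>\<^sub>0 int) set" where
  "LB_boundary X t n =
     induced_map (lb_chain X (n - 1)) (lb_degenerate X (n - 1)) (lb_boundary t n)"

definition LB_homology ::
    "'x set \<Rightarrow> ('x \<Rightarrow> 'x \<Rightarrow> 'x \<Rightarrow> 'x) \<Rightarrow> 'a monoid \<Rightarrow>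
     int \<Rightarrow> ((('x \<times> 'x) list \<Rightarrow>\<^sub>0 int) set \<times> 'a \<Rightarrow>\<^sub>0 int) set set monoid" where
  "LB_homology X t = homology_coeff (LB_chain X) (LB_boundary X t)"

definition LB_cohomology ::
    "'x set \<Rightarrow> ('x \<Rightarrow> 'x \<Rightarrow> 'x \<Rightarrow> 'x) \<Rightarrow> 'a monoid \<Rightarrow>
     int \<Rightarrow> ((('x \<times> 'x) list \<Rightarrow>\<^sub>0 int) set \<Rightarrow> 'a) set monoid" where
  "LB_cohomology X t = cohomology_coeff (LB_chain X) (LB_boundary X t)"

end

theory Submission
  imports Defs
begin

text \<open>
  Strong connectivity makes \<open>(x, a\<^sub>1, \<dots>, a\<^sub>n) \<mapsto> ((x, x * a\<^sub>1), \<dots>, (x, x * a\<^sub>n))\<close> a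
  bijection between the two bases. It matches degenerate tuples with degenerate tuples, and since the
  tribracket of \<open>x\<close>, \<open>x * a\<close>, \<open>x * b\<close> has the two expressions \<open>(x * a) * (b \<triangleright> a)\<close> and
  \<open>(x * b) * (a \<triangleleft> b)\<close>, it matches the faces too. So the two quotient complexes are
  isomorphic, and this passes to tensor products, homomorphism groups and subquotients. That the
  boundary squares to zero plays no role: images of maps transport subquotients as they are.
\<close>

section \<open>Transport of quotients and (co)homology along isomorphisms\<close>

text \<open>Taking images under \<open>f\<close> turns cosets of \<open>I\<close> into cosets of its
  image and respects set products; injectivity of \<open>f\<close> on the carrier makes it injective
  on the cosets. With \<open>K\<close> and \<open>I\<close> as plain subsets, the statement covers
  full quotients as well as kernels modulo boundaries.\<close>

lemma Mod_image_iso: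
  assumes "group G" and f: "f \<in> hom G H" and inj: "inj_on f (carrier G)"
    and K: "K \<subseteq> carrier G" and I: "I \<subseteq> carrier G"
  shows "(`) f \<in> iso (G\<lparr>carrier := K\<rparr> Mod I) (H\<lparr>carrier := f ` K\<rparr> Mod f ` I)"
proof -
  interpret group G by fact
  have rcos: "f ` (I #>\<^bsub>G\<^esub> a) = f ` I #>\<^bsub>H\<^esub> f a" if "a \<in> K" for a
    using coset_hom(2)[OF f I] that K by blast
  have sub: "U \<subseteq> carrier G" if U: "U \<in> rcosets\<^bsub>G\<lparr>carrier := K\<rparr>\<^esub> I" for U
    proof -
    obtain a where "a \<in> K" "U = I #>\<^bsub>G\<^esub> a"
      using U by (auto simp: RCOSETS_def)
    then show ?thesis
      using K r_coset_subset_G[OF I] by auto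
  qed
  have mult: "f ` (U <#>\<^bsub>G\<^esub> V) = f ` U <#>\<^bsub>H\<^esub> f ` V"
    if "U \<in> rcosets\<^bsub>G\<lparr>carrier := K\<rparr>\<^esub> I" "V \<in> rcosets\<^bsub>G\<lparr>carrier := K\<rparr>\<^esub> I" for U V
    by (intro set_mult_hom[OF f] sub that)
  have img: "(`) f ` (rcosets\<^bsub>G\<lparr>carrier := K\<rparr>\<^esub> I) = rcosets\<^bsub>H\<lparr>carrier := f ` K\<rparr>\<^esub> (f ` I)"
    by (simp add: RCOSETS_def rcos image_UN)
  have inj': "inj_on ((`) f) (rcosets\<^bsub>G\<lparr>carrier := K\<rparr>\<^esub> I)"
    by (rule inj_onI) (use inj_on_image_eq_iff[OF inj] sub in blast)
  \<comment> \<open>The set product refers to the multiplication only, so changing the carrier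
    leaves it alone.\<close>
  have [simp]: "(<#>\<^bsub>G\<lparr>carrier := K\<rparr>\<^esub>) = (<#>\<^bsub>G\<^esub>)"
    "(<#>\<^bsub>H\<lparr>carrier := f ` K\<rparr>\<^esub>) = (<#>\<^bsub>H\<^esub>)"
    by (simp_all add: set_mult_def fun_eq_iff)
  show ?thesis
    unfolding iso_def hom_def bij_betw_def FactGroup_def
    using img inj' mult by (simp add: Pi_iff flip: img)
qed

lemma Mod_iso:
  assumes "group G" "f \<in> iso G H" "N \<subseteq> carrier G"
  shows "(`) f \<in> iso (G Mod N) (H Mod f ` N)"
proof -
  have "f \<in> hom G H" "inj_on f (carrier G)" "f ` carrier G = carrier H"
    using assms(2) by (auto simp: iso_def bij_betw_def)
  then show ?thesis
    using Mod_image_iso[OF assms(1) _ _ subset_refl assms(3), of f H] by simp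
qed

text \<open>Surjectivity of \<open>f\<close> writes every element of \<open>G'\<close> as some
  \<open>f a\<close>, where the square determines \<open>h'\<close>. So a boundary map on the target
  inherits the homomorphism property from the source, without being unfolded.\<close>

lemma hom_transport:
  assumes f: "f \<in> iso G G'" and p: "p \<in> hom H H'" and h: "h \<in> hom G H" and "group G"
    and sq: "\<And>c. c \<in> carrier G \<Longrightarrow> h' (f c) = p (h c)"
  shows "h' \<in> hom G' H'"
proof -
  interpret group G by fact
  have f_hom: "f \<in> hom G G'" and surj: "carrier G' = f ` carrier G"
    using f by (auto simp: iso_def bij_betw_def)
  show ?thesis
  proof (rule homI)
    fix x y
    assume "x \<in> carrier G'" "y \<in> carrier G'"
    then obtain a b where ab: "a \<in> carrier G" "x = f a" "b \<in> carrier G" "y = f b"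
      using surj by blast
    then show "h' x \<in> carrier H'"
      using sq p h by (auto simp: hom_def)
    have "x \<otimes>\<^bsub>G'\<^esub> y = f (a \<otimes>\<^bsub>G\<^esub> b)"
      using ab hom_mult[OF f_hom] by simp
    then show "h' (x \<otimes>\<^bsub>G'\<^esub> y) = h' x \<otimes>\<^bsub>H'\<^esub> h' y"
      using ab sq hom_mult[OF h, of a b] hom_mult[OF p, of "h a" "h b"] hom_in_carrier[OF h]
      by simp
  qed
qed

text \<open>On a coset represented by \<open>c\<close>, both sides are the image under
  \<open>p\<close> of the coset of \<open>h c\<close>. The lemma serves twice: for chains modulo
  degenerate chains and for tensor products modulo their relations.\<close>

lemma induced_map_transport:
  assumes G: "group G" and H: "group H" and G': "group G'" and H': "group H'"
    and f: "f \<in> iso G G'" and p: "p \<in> iso H H'" and h: "h \<in> hom G H"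
    and sq: "\<And>c. c \<in> carrier G \<Longrightarrow> h' (f c) = p (h c)"
    and N: "subgroup N G" and M: "subgroup M H" and hN: "h ` N \<subseteq> M"
    and K: "K \<in> carrier (G Mod N)"
  shows "induced_map H' (p ` M) h' (f ` K) = p ` induced_map H M h K"
proof -
  have f_hom: "f \<in> hom G G'" and p_hom: "p \<in> hom H H'"
    using f p by (auto simp: iso_def)
  interpret f: group_hom G G' f
    using G G' f_hom by (simp add: group_hom_def group_hom_axioms_def)
  interpret p: group_hom H H' p
    using H H' p_hom by (simp add: group_hom_def group_hom_axioms_def)
  obtain c where c: "c \<in> carrier G" "K = N #>\<^bsub>G\<^esub> c"
    using K by (auto simp: FactGroup_def RCOSETS_def)
  have "h' ` f ` N \<subseteq> p ` M"
    using sq hN subgroup.subset[OF N] by (auto simp: image_subset_iff)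
  then have "induced_map H' (p ` M) h' (f ` N #>\<^bsub>G'\<^esub> f c) = p ` M #>\<^bsub>H'\<^esub> h' (f c)"
    using G' H' hom_transport[OF f p_hom h G sq] f.subgroup_img_is_subgroup[OF N]
      p.subgroup_img_is_subgroup[OF M] c(1)
    by (intro induced_map_coset) auto
  also have "\<dots> = p ` (M #>\<^bsub>H\<^esub> h c)"
    using coset_hom(2)[OF p_hom subgroup.subset[OF M] hom_in_carrier[OF h c(1)]] sq[OF c(1)] by simp
  finally show ?thesis
    using coset_hom(2)[OF f_hom subgroup.subset[OF N] c(1)]
      induced_map_coset[OF G H h N M hN c(1)] c(2) by simp
qed

text \<open>Commutativity of \<open>H\<close> makes \<open>M\<close> normal; the induced map can
  then be computed on representatives.\<close>

lemma induced_map_hom: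
  assumes G: "group G" and H: "comm_group H" and h: "h \<in> hom G H"
    and N: "N \<lhd> G" and M: "subgroup M H" and hN: "h ` N \<subseteq> M"
  shows "induced_map H M h \<in> hom (G Mod N) (H Mod M)"
proof -
  interpret N: normal N G by fact
  interpret M: normal M H
    using comm_group.subgroup_imp_normal[OF H M] .
  have eq: "induced_map H M h (N #>\<^bsub>G\<^esub> c) = M #>\<^bsub>H\<^esub> h c" if "c \<in> carrier G" for c
    using induced_map_coset[OF G M.is_group h N.subgroup_axioms M hN that] .
  show ?thesis
  proof (rule homI)
    fix U V
    assume "U \<in> carrier (G Mod N)" "V \<in> carrier (G Mod N)"
    then obtain a b where ab: "a \<in> carrier G" "U = N #>\<^bsub>G\<^esub> a" "b \<in> carrier G" "V = N #>\<^bsub>G\<^esub> b"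
      by (auto simp: FactGroup_def RCOSETS_def)
    then show "induced_map H M h U \<in> carrier (H Mod M)"
      using hom_in_carrier[OF h] by (auto simp: eq FactGroup_def RCOSETS_def)
    show "induced_map H M h (U \<otimes>\<^bsub>G Mod N\<^esub> V) =
        induced_map H M h U \<otimes>\<^bsub>H Mod M\<^esub> induced_map H M h V"
      using ab hom_in_carrier[OF h] hom_mult[OF h]
      by (simp add: FactGroup_def N.rcos_sum M.rcos_sum eq)
  qed
qed

text \<open>One inclusion is induction on the generation process; the other holds because the image
  of a subgroup is a subgroup, and this one contains the images of the generators.\<close>

lemma generate_hom_image:
  assumes "group G" "group H" "f \<in> hom G H" "S \<subseteq> carrier G"
  shows "f ` generate G S = generate H (f ` S)"
proof
  interpret f: group_hom G H f
    using assms by (simp add: group_hom_def group_hom_axioms_def)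
  show "f ` generate G S \<subseteq> generate H (f ` S)"
  proof clarify
    fix c
    assume "c \<in> generate G S"
    then show "f c \<in> generate H (f ` S)"
    proof induction
      case (inv h)
      then show ?case
        using assms(4) generate.inv[of "f h" "f ` S" H] by auto
    next
      case (eng h1 h2)
      then show ?case
        using group.generate_in_carrier[OF assms(1,4)] by (auto intro: generate.eng)
    qed (auto intro: generate.intros)
  qed
  show "generate H (f ` S) \<subseteq> f ` generate G S"
    by (rule f.H.generate_subgroup_incl)
      (use assms(4) in \<open>auto intro: generate.incl f.subgroup_img_is_subgroup group.generate_is_subgroup[OF assms(1)]\<close>)
qed

text \<open>Since \<open>p\<close> is injective and preserves the identity, \<open>f\<close> carries
  the kernel of \<open>h\<close> onto the kernel of \<open>h'\<close>. The rest is
  \<open>Mod_image_iso\<close> with the kernel as \<open>K\<close>.\<close>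

lemma subquotient_iso:
  assumes G: "group G" and "group H" "group H'"
    and f: "f \<in> iso G G'" and p: "p \<in> iso H H'" and h: "h \<in> carrier G \<rightarrow> carrier H"
    and sq: "\<And>c. c \<in> carrier G \<Longrightarrow> h' (f c) = p (h c)" and I: "I \<subseteq> carrier G"
  shows "subquotient G H h I \<cong> subquotient G' H' h' (f ` I)"
proof -
  have f': "f \<in> hom G G'" "inj_on f (carrier G)" "carrier G' = f ` carrier G"
    using f by (auto simp: iso_def bij_betw_def)
  have p': "p \<in> hom H H'" "inj_on p (carrier H)"
    using p by (auto simp: iso_def bij_betw_def)
  have one: "p \<one>\<^bsub>H\<^esub> = \<one>\<^bsub>H'\<^esub>"
    using hom_one p' assms by blast
  have "p (h c) = \<one>\<^bsub>H'\<^esub> \<longleftrightarrow> h c = \<one>\<^bsub>H\<^esub>" if "c \<in> carrier G" for c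
    using that h inj_on_eq_iff[OF p'(2), of "h c" "\<one>\<^bsub>H\<^esub>"] one monoid.one_closed[OF group.is_monoid[OF \<open>group H\<close>]]
    by auto
  then have "kernel G' H' h' = f ` kernel G H h"
    using f'(3) sq by (auto simp: kernel_def one)
  then show ?thesis
    using Mod_image_iso[OF G f'(1,2) _ I, of "kernel G H h"]
    unfolding subquotient_def is_iso_def by (auto simp: kernel_def)
qed

text \<open>The square in degree \<open>n\<close> matches the kernels, the one in degree
  \<open>n + 1\<close> matches the boundaries.\<close>

lemma homology_iso:
  assumes C: "\<And>n. group (C n)" and C': "\<And>n. group (C' n)"
    and f: "\<And>n. f n \<in> iso (C n) (C' n)"
    and d: "\<And>n. d n \<in> carrier (C n) \<rightarrow> carrier (C (n - 1))"
    and sq: "\<And>n c. c \<in> carrier (C n) \<Longrightarrow> d' n (f n c) = f (n - 1) (d n c)"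
  shows "homology C d n \<cong> homology C' d' n"
proof -
  have "d (n + 1) ` carrier (C (n + 1)) \<subseteq> carrier (C n)"
    using d[of "n + 1"] by auto
  moreover have "carrier (C' (n + 1)) = f (n + 1) ` carrier (C (n + 1))"
    using f by (simp add: iso_def bij_betw_def)
  then have "d' (n + 1) ` carrier (C' (n + 1)) = f n ` d (n + 1) ` carrier (C (n + 1))"
    using sq[of _ "n + 1"] by (force simp: image_image)
  ultimately show ?thesis
    unfolding homology_def using subquotient_iso[OF C C C' f f d sq] by simp
qed

text \<open>As for homology with the index shift reversed: the incoming map starts in degree
  \<open>n - 1\<close>.\<close>

lemma cohomology_iso:
  assumes C: "\<And>n. group (C n)" and C': "\<And>n. group (C' n)"
    and f: "\<And>n. f n \<in> iso (C n) (C' n)"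
    and d: "\<And>n. d n \<in> carrier (C n) \<rightarrow> carrier (C (n + 1))"
    and sq: "\<And>n c. c \<in> carrier (C n) \<Longrightarrow> d' n (f n c) = f (n + 1) (d n c)"
  shows "cohomology C d n \<cong> cohomology C' d' n"
proof -
  have "d (n - 1) ` carrier (C (n - 1)) \<subseteq> carrier (C n)"
    using d[of "n - 1"] by auto
  moreover have "carrier (C' (n - 1)) = f (n - 1) ` carrier (C (n - 1))"
    using f by (simp add: iso_def bij_betw_def)
  then have "d' (n - 1) ` carrier (C' (n - 1)) = f n ` d (n - 1) ` carrier (C (n - 1))"
    using sq[of _ "n - 1"] by (force simp: image_image)
  ultimately show ?thesis
    unfolding cohomology_def using subquotient_iso[OF C C C' f f d sq] by simp
qed

section \<open>Free abelian groups and tensor products\<close>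

lemma frag_extend_hom:
  assumes "\<And>s. s \<in> S \<Longrightarrow> Poly_Mapping.keys (f s) \<subseteq> T"
  shows "frag_extend f \<in> hom (free_Abelian_group S) (free_Abelian_group T)"
proof (rule homI)
  fix x
  assume "x \<in> carrier (free_Abelian_group S)"
  then show "frag_extend f x \<in> carrier (free_Abelian_group T)"
    using keys_frag_extend[of f x] assms by fastforce
qed (simp add: frag_extend_add)

lemma frag_extend_extend:
  "frag_extend f (frag_extend g c) = frag_extend (\<lambda>x. frag_extend f (g x)) c"
  by (induction c rule: frag_induction[OF subset_UNIV]) (auto simp: frag_extend_diff)

text \<open>The linear extension of the inverse bijection is a two-sided inverse.\<close>

lemma frag_extend_iso:
  assumes "bij_betw \<phi> S T"
  shows "frag_extend (\<lambda>s. frag_of (\<phi> s)) \<in> iso (free_Abelian_group S) (free_Abelian_group T)"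
proof -
  define \<psi> where "\<psi> = inv_into S \<phi>"
  have \<phi>: "\<phi> s \<in> T" "\<psi> (\<phi> s) = s" if "s \<in> S" for s
    using assms that by (auto simp: \<psi>_def bij_betw_inv_into_left bij_betwE)
  have \<psi>: "\<psi> t \<in> S" "\<phi> (\<psi> t) = t" if "t \<in> T" for t
    using assms that by (auto simp: \<psi>_def bij_betw_inv_into_right bij_betwE[OF bij_betw_inv_into])
  \<comment> \<open>Stated with its own types, so that it applies to both composites of the two
    extensions.\<close>
  have cancel: "frag_extend (\<lambda>t. frag_of (\<beta> t)) (frag_extend (\<lambda>s. frag_of (\<alpha> s)) c) = c"
    if "\<And>s. s \<in> S \<Longrightarrow> \<beta> (\<alpha> s) = s" "Poly_Mapping.keys c \<subseteq> S"
    for \<alpha> :: "'c \<Rightarrow> 'd" and \<beta> and S :: "'c set" and c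
  proof -
    have "frag_extend (\<lambda>s. frag_of (\<beta> (\<alpha> s))) c = frag_extend frag_of c"
      using that by (intro frag_extend_eq) auto
    then show ?thesis
      by (simp add: frag_extend_extend flip: frag_expansion)
  qed
  show ?thesis
    unfolding iso_def
  proof (intro CollectI conjI)
    show "frag_extend (\<lambda>s. frag_of (\<phi> s)) \<in> hom (free_Abelian_group S) (free_Abelian_group T)"
      using \<phi> by (intro frag_extend_hom) simp
    moreover have "frag_extend (\<lambda>s. frag_of (\<psi> s)) \<in> hom (free_Abelian_group T) (free_Abelian_group S)"
      using \<psi> by (intro frag_extend_hom) simp
    ultimately show "bij_betw (frag_extend (\<lambda>s. frag_of (\<phi> s))) (carrier (free_Abelian_group S))
        (carrier (free_Abelian_group T))"
      using cancel[of S \<psi> \<phi>, OF \<phi>(2)] cancel[of T \<phi> \<psi>, OF \<psi>(2)]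
      by (intro bij_betw_byWitness[where f' = "frag_extend (\<lambda>s. frag_of (\<psi> s))"])
        (simp_all add: hom_def Pi_iff image_subset_iff)
  qed
qed

section \<open>Tensor products and homology with coefficients\<close>

abbreviation tensor_lift :: "('g \<Rightarrow> 'h) \<Rightarrow> ('g \<times> 'a \<Rightarrow>\<^sub>0 int) \<Rightarrow> ('h \<times> 'a \<Rightarrow>\<^sub>0 int)" where
  "tensor_lift h \<equiv> frag_extend (\<lambda>s. frag_of (map_prod h id s))"

text \<open>The pattern abstraction in \<open>tensor_map\<close> is the same function as
  \<open>frag_of\<close> after \<open>map_prod h id\<close>; the latter form makes the lift an
  instance of \<open>frag_extend_iso\<close>.\<close>

lemma tensor_map_eq:
  fixes A :: "('a, 'k) monoid_scheme"
  shows "tensor_map H A h =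
    induced_map (free_Abelian_group (carrier H \<times> carrier A)) (tensor_relations H A) (tensor_lift h)"
proof -
  have "(\<lambda>(g, a :: 'a). frag_of (h g, a)) = (\<lambda>s. frag_of (map_prod h id s))"
    by auto
  then show ?thesis
    by (simp add: tensor_map_def)
qed

text \<open>The generating set of \<open>tensor_relations\<close>, named so that images under
  \<open>tensor_lift\<close> can be checked on generators.\<close>

definition tensor_relators ::
    "('g, 'm) monoid_scheme \<Rightarrow> ('a, 'k) monoid_scheme \<Rightarrow> ('g \<times> 'a \<Rightarrow>\<^sub>0 int) set" where
  "tensor_relators G A =
     {frag_of (g \<otimes>\<^bsub>G\<^esub> g', a) - frag_of (g, a) - frag_of (g', a) | g g' a.
         g \<in> carrier G \<and> g' \<in> carrier G \<and> a \<in> carrier A} \<union>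
     {frag_of (g, a \<otimes>\<^bsub>A\<^esub> a') - frag_of (g, a) - frag_of (g, a') | g a a'.
         g \<in> carrier G \<and> a \<in> carrier A \<and> a' \<in> carrier A}"

lemma tensor_relations_eq:
  "tensor_relations G A =
    generate (free_Abelian_group (carrier G \<times> carrier A)) (tensor_relators G A)"
  by (simp add: tensor_relations_def tensor_relators_def)

lemma tensor_relators_closed:
  assumes "monoid G" "monoid A"
  shows "tensor_relators G A \<subseteq> carrier (free_Abelian_group (carrier G \<times> carrier A))"
proof
  fix c
  assume "c \<in> tensor_relators G A"
  \<comment> \<open>Both kinds of relator have this shape, and only membership of the three basis
    elements matters.\<close>
  then obtain u v w where "c = frag_of u - frag_of v - frag_of w"
    "{u, v, w} \<subseteq> carrier G \<times> carrier A"
    using assms by (auto simp: tensor_relators_def monoid.m_closed)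
  then show "c \<in> carrier (free_Abelian_group (carrier G \<times> carrier A))"
    using keys_diff[of "frag_of u - frag_of v" "frag_of w"] keys_diff[of "frag_of u" "frag_of v"]
    by auto
qed

lemma subgroup_tensor_relations:
  assumes "monoid G" "monoid A"
  shows "subgroup (tensor_relations G A) (free_Abelian_group (carrier G \<times> carrier A))"
  unfolding tensor_relations_eq
  by (intro group.generate_is_subgroup tensor_relators_closed assms group_free_Abelian_group)

lemma comm_group_tensor_group:
  assumes "monoid G" "monoid A"
  shows "comm_group (tensor_group G A)"
  unfolding tensor_group_def
  by (intro comm_group.abelian_FactGroup abelian_free_Abelian_group subgroup_tensor_relations assms)

lemma tensor_lift_hom:
  assumes "h \<in> hom G H"
  shows "tensor_lift h \<in> hom (free_Abelian_group (carrier G \<times> carrier A))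
    (free_Abelian_group (carrier H \<times> carrier A))"
  using assms by (intro frag_extend_hom) (auto simp: hom_def)

lemma tensor_lift_iso:
  assumes "f \<in> iso G H"
  shows "tensor_lift f \<in> iso (free_Abelian_group (carrier G \<times> carrier A))
    (free_Abelian_group (carrier H \<times> carrier A))"
  using assms
  by (intro frag_extend_iso) (auto simp: iso_def intro!: bij_betw_map_prod)

text \<open>Each family goes to the family of the same kind: \<open>h\<close> preserves products in
  the first factor, and \<open>id\<close> fixes the second.\<close>

lemma tensor_lift_relators:
  assumes "h \<in> hom G H"
  shows "tensor_lift h ` tensor_relators G A \<subseteq> tensor_relators H A"
proof -
  have h: "h (g \<otimes>\<^bsub>G\<^esub> g') = h g \<otimes>\<^bsub>H\<^esub> h g'" "h g \<in> carrier H"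
    if "g \<in> carrier G" "g' \<in> carrier G" for g g'
    using assms that by (auto simp: hom_def)
  show ?thesis
  proof clarify
    fix c :: "'a \<times> 'e \<Rightarrow>\<^sub>0 int"
    assume "c \<in> tensor_relators G A"
    then consider
      (left) g g' a where "g \<in> carrier G" "g' \<in> carrier G" "a \<in> carrier A"
        "c = frag_of (g \<otimes>\<^bsub>G\<^esub> g', a) - frag_of (g, a) - frag_of (g', a)"
    | (right) g a a' where "g \<in> carrier G" "a \<in> carrier A" "a' \<in> carrier A"
        "c = frag_of (g, a \<otimes>\<^bsub>A\<^esub> a') - frag_of (g, a) - frag_of (g, a')"
      unfolding tensor_relators_def by blast
    then show "tensor_lift h c \<in> tensor_relators H A"
    proof cases
      case left
      then have "tensor_lift h c = frag_of (h g \<otimes>\<^bsub>H\<^esub> h g', a) - frag_of (h g, a) - frag_of (h g', a)"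
        by (simp add: frag_extend_diff h)
      then show ?thesis
        using left h unfolding tensor_relators_def by blast
    next
      case right
      then have "tensor_lift h c = frag_of (h g, a \<otimes>\<^bsub>A\<^esub> a') - frag_of (h g, a) - frag_of (h g, a')"
        by (simp add: frag_extend_diff)
      then show ?thesis
        using right h unfolding tensor_relators_def by blast
    qed
  qed
qed

lemma tensor_lift_relations:
  assumes "h \<in> hom G H" "monoid G" "monoid H" "monoid A"
  shows "tensor_lift h ` tensor_relations G A \<subseteq> tensor_relations H A"
  unfolding tensor_relations_eq
  by (simp add: generate_hom_image[OF _ _ tensor_lift_hom[OF assms(1)] tensor_relators_closed[OF assms(2,4)]]
      group.mono_generate tensor_lift_relators[OF assms(1)])

text \<open>The general inclusion is applied to \<open>f\<close> and to its inverse
  \<open>g\<close>; they combine to an equality because lifting \<open>g\<close> and then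
  \<open>f\<close> changes nothing.\<close>

lemma tensor_lift_relations_iso:
  assumes f: "f \<in> iso G H" and G: "group G" and "monoid H" "monoid A"
  shows "tensor_lift f ` tensor_relations G A = tensor_relations H A"
proof
  have G': "monoid G"
    using G by (rule group.is_monoid)
  have hom: "f \<in> hom G H"
    using f by (simp add: iso_def)
  then show "tensor_lift f ` tensor_relations G A \<subseteq> tensor_relations H A"
    using G' assms by (intro tensor_lift_relations)
  define g where "g = inv_into (carrier G) f"
  have g: "g \<in> hom H G" "\<And>y. y \<in> carrier H \<Longrightarrow> f (g y) = y"
    using group.iso_set_sym[OF G f] f
    by (auto simp: g_def iso_def bij_betw_inv_into_right)
  have cancel: "tensor_lift f (tensor_lift g c) = c"
    if "c \<in> carrier (free_Abelian_group (carrier H \<times> carrier A))" for c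
  proof -
    have "frag_extend (\<lambda>s. frag_of (map_prod f id (map_prod g id s))) c = frag_extend frag_of c"
      using that g(2) by (intro frag_extend_eq) auto
    then show ?thesis
      by (simp add: frag_extend_extend flip: frag_expansion)
  qed
  have lift_g: "tensor_lift g ` tensor_relations H A \<subseteq> tensor_relations G A"
    using G' g assms by (intro tensor_lift_relations)
  show "tensor_relations H A \<subseteq> tensor_lift f ` tensor_relations G A"
  proof
    fix c
    assume c: "c \<in> tensor_relations H A"
    then have "c = tensor_lift f (tensor_lift g c)"
      using subgroup.mem_carrier[OF subgroup_tensor_relations[OF \<open>monoid H\<close> \<open>monoid A\<close>]] cancel by simp
    then show "c \<in> tensor_lift f ` tensor_relations G A"
      using lift_g c by blast
  qed
qed

text \<open>Tensoring the maps \<open>f n\<close> with \<open>A\<close> gives isomorphisms of the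
  tensor groups, and the square persists because it can be checked on basis elements.\<close>

lemma homology_coeff_iso:
  assumes C: "\<And>n. group (C n)" and C': "\<And>n. group (C' n)" and A: "group A"
    and f: "\<And>n. f n \<in> iso (C n) (C' n)"
    and d: "\<And>n. d n \<in> hom (C n) (C (n - 1))"
    and sq: "\<And>n c. c \<in> carrier (C n) \<Longrightarrow> d' n (f n c) = f (n - 1) (d n c)"
  shows "homology_coeff C d A n \<cong> homology_coeff C' d' A n"
  unfolding homology_coeff_def
proof (rule homology_iso[where f = "\<lambda>n. (`) (tensor_lift (f n))"])
  note monoids = group.is_monoid[OF C] group.is_monoid[OF C'] group.is_monoid[OF A]
  note rel = tensor_lift_relations_iso[OF f C monoids(2,3)]
  fix n
  show "group (tensor_group (C n) A)" "group (tensor_group (C' n) A)"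
    using comm_group_tensor_group[OF _ monoids(3)] monoids(1,2) comm_group.axioms(2) by blast+
  show "(`) (tensor_lift (f n)) \<in> iso (tensor_group (C n) A) (tensor_group (C' n) A)"
    \<comment> \<open>Rewriting the relations of the target as an image puts the goal in the form of
      \<open>Mod_iso\<close>.\<close>
    unfolding tensor_group_def rel[symmetric]
    by (intro Mod_iso group_free_Abelian_group tensor_lift_iso f subgroup.subset
        subgroup_tensor_relations monoids)
  have "tensor_map (C (n - 1)) A (d n) \<in> hom (tensor_group (C n) A) (tensor_group (C (n - 1)) A)"
    unfolding tensor_group_def tensor_map_eq
    by (intro induced_map_hom group_free_Abelian_group abelian_free_Abelian_group tensor_lift_hom d
        comm_group.subgroup_imp_normal subgroup_tensor_relations monoids tensor_lift_relations)
  then show "tensor_map (C (n - 1)) A (d n) \<in>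
      carrier (tensor_group (C n) A) \<rightarrow> carrier (tensor_group (C (n - 1)) A)"
    by (simp add: hom_def)
  fix K
  assume K: "K \<in> carrier (tensor_group (C n) A)"
  have "tensor_lift (d' n) (tensor_lift (f n) c) = tensor_lift (f (n - 1)) (tensor_lift (d n) c)"
    if "c \<in> carrier (free_Abelian_group (carrier (C n) \<times> carrier A))" for c
    using that sq unfolding frag_extend_extend by (intro frag_extend_eq) auto
  then show "tensor_map (C' (n - 1)) A (d' n) (tensor_lift (f n) ` K) =
      tensor_lift (f (n - 1)) ` tensor_map (C (n - 1)) A (d n) K"
    using K unfolding tensor_group_def tensor_map_eq rel[symmetric]
    by (intro induced_map_transport[where G' = "free_Abelian_group (carrier (C' n) \<times> carrier A)"
          and G = "free_Abelian_group (carrier (C n) \<times> carrier A)"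
          and H = "free_Abelian_group (carrier (C (n - 1)) \<times> carrier A)"])
      (simp_all add: tensor_lift_iso[OF f] tensor_lift_hom[OF d] subgroup_tensor_relations
        tensor_lift_relations[OF d] monoids)
qed

section \<open>Homomorphism groups\<close>

text \<open>Commutativity of \<open>A\<close> makes pointwise products and inverses of homomorphisms
  homomorphisms again.\<close>

lemma group_hom_group:
  assumes "monoid G" "comm_group A"
  shows "group (hom_group G A)"
proof (rule groupI)
  interpret G: monoid G by fact
  interpret A: comm_group A by fact
  fix f g h
  assume f: "f \<in> carrier (hom_group G A)"
  then have f': "f \<in> extensional (carrier G)" "\<And>x. x \<in> carrier G \<Longrightarrow> f x \<in> carrier A"
      "\<And>x y. x \<in> carrier G \<Longrightarrow> y \<in> carrier G \<Longrightarrow> f (x \<otimes>\<^bsub>G\<^esub> y) = f x \<otimes>\<^bsub>A\<^esub> f y"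
    by (auto simp: hom_group_def hom_def)
  show "\<one>\<^bsub>hom_group G A\<^esub> \<otimes>\<^bsub>hom_group G A\<^esub> f = f"
    using f' by (auto simp: hom_group_def fun_eq_iff extensional_def)
  have "(\<lambda>x\<in>carrier G. inv\<^bsub>A\<^esub> f x) \<in> carrier (hom_group G A)"
    using f' by (auto simp: hom_group_def hom_def A.inv_mult)
  moreover have "(\<lambda>x\<in>carrier G. inv\<^bsub>A\<^esub> f x) \<otimes>\<^bsub>hom_group G A\<^esub> f = \<one>\<^bsub>hom_group G A\<^esub>"
    using f' by (auto simp: hom_group_def fun_eq_iff)
  ultimately show "\<exists>g \<in> carrier (hom_group G A). g \<otimes>\<^bsub>hom_group G A\<^esub> f = \<one>\<^bsub>hom_group G A\<^esub>"
    by blast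
  assume g: "g \<in> carrier (hom_group G A)"
  then have g': "\<And>x. x \<in> carrier G \<Longrightarrow> g x \<in> carrier A"
      "\<And>x y. x \<in> carrier G \<Longrightarrow> y \<in> carrier G \<Longrightarrow> g (x \<otimes>\<^bsub>G\<^esub> y) = g x \<otimes>\<^bsub>A\<^esub> g y"
    by (auto simp: hom_group_def hom_def)
  show "f \<otimes>\<^bsub>hom_group G A\<^esub> g \<in> carrier (hom_group G A)"
    using f' g' by (auto simp: hom_group_def hom_def A.m_ac)
  assume "h \<in> carrier (hom_group G A)"
  then have "\<And>x. x \<in> carrier G \<Longrightarrow> h x \<in> carrier A"
    by (auto simp: hom_group_def hom_def)
  then show "f \<otimes>\<^bsub>hom_group G A\<^esub> g \<otimes>\<^bsub>hom_group G A\<^esub> h =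
      f \<otimes>\<^bsub>hom_group G A\<^esub> (g \<otimes>\<^bsub>hom_group G A\<^esub> h)"
    using f' g' by (auto simp: hom_group_def fun_eq_iff A.m_assoc)
next
  interpret A: comm_group A by fact
  show "\<one>\<^bsub>hom_group G A\<^esub> \<in> carrier (hom_group G A)"
    using monoid.m_closed[OF assms(1)] by (auto simp: hom_group_def hom_def)
qed

lemma hom_group_compose_closed:
  assumes "h \<in> hom G H" "\<phi> \<in> carrier (hom_group H A)" "monoid G"
  shows "compose (carrier G) \<phi> h \<in> carrier (hom_group G A)"
  using assms by (auto simp: hom_group_def hom_def compose_def monoid.m_closed Pi_iff)

text \<open>Precomposition with the inverse of \<open>g\<close> undoes precomposition with
  \<open>g\<close>. As elements of the homomorphism groups are restricted to the carriers, the
  composites are equal to the identity as functions.\<close>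

lemma hom_group_iso:
  assumes g: "g \<in> iso G' G" and G': "group G'" and G: "monoid G"
  shows "(\<lambda>\<phi>. compose (carrier G') \<phi> g) \<in> iso (hom_group G A) (hom_group G' A)"
proof -
  have g_hom: "g \<in> hom G' G" and g_bij: "bij_betw g (carrier G') (carrier G)"
    using g by (auto simp: iso_def)
  define f where "f = inv_into (carrier G') g"
  have f: "f \<in> hom G G'"
    using group.iso_set_sym[OF G' g] by (simp add: f_def iso_def)
  have fg: "f (g x) = x" if "x \<in> carrier G'" for x
    using bij_betw_inv_into_left[OF g_bij that] by (simp add: f_def)
  have gf: "g (f y) = y" if "y \<in> carrier G" for y
    using bij_betw_inv_into_right[OF g_bij that] by (simp add: f_def)
  note closed = hom_group_compose_closed[OF g_hom _ group.is_monoid[OF G']]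
    hom_group_compose_closed[OF f _ G]
  show ?thesis
    unfolding iso_def
  proof (intro CollectI conjI homI closed)
    fix \<phi> \<psi>
    show "compose (carrier G') (\<phi> \<otimes>\<^bsub>hom_group G A\<^esub> \<psi>) g =
        compose (carrier G') \<phi> g \<otimes>\<^bsub>hom_group G' A\<^esub> compose (carrier G') \<psi> g"
      using hom_in_carrier[OF g_hom] by (auto simp: hom_group_def compose_def fun_eq_iff)
  next
    have "compose (carrier G) (compose (carrier G') \<phi> g) f = \<phi>"
      if "\<phi> \<in> carrier (hom_group G A)" for \<phi>
      using that gf hom_in_carrier[OF f]
      by (auto simp: hom_group_def compose_def fun_eq_iff extensional_def)
    moreover have "compose (carrier G') (compose (carrier G) \<phi> f) g = \<phi>"
      if "\<phi> \<in> carrier (hom_group G' A)" for \<phi>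
      using that fg hom_in_carrier[OF g_hom]
      by (auto simp: hom_group_def compose_def fun_eq_iff extensional_def)
    ultimately show "bij_betw (\<lambda>\<phi>. compose (carrier G') \<phi> g) (carrier (hom_group G A))
        (carrier (hom_group G' A))"
      using closed
      by (intro bij_betw_byWitness[where f' = "\<lambda>\<phi>. compose (carrier G) \<phi> f"]) auto
  qed
qed

text \<open>Homomorphism groups are contravariant, so the isomorphism in degree \<open>n\<close> is
  precomposition with the inverse \<open>g n\<close>, and the square for \<open>f\<close> is first
  turned into one for \<open>g\<close>.\<close>

lemma cohomology_coeff_iso:
  assumes C: "\<And>n. group (C n)" and C': "\<And>n. group (C' n)" and A: "comm_group A"
    and f: "\<And>n. f n \<in> iso (C n) (C' n)"
    and d: "\<And>n. d n \<in> hom (C n) (C (n - 1))"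
    and sq: "\<And>n c. c \<in> carrier (C n) \<Longrightarrow> d' n (f n c) = f (n - 1) (d n c)"
  shows "cohomology_coeff C d A n \<cong> cohomology_coeff C' d' A n"
proof -
  define g where "g = (\<lambda>n. inv_into (carrier (C n)) (f n))"
  have g: "g n \<in> iso (C' n) (C n)" for n
    using group.iso_set_sym[OF C f] by (simp add: g_def)
  have gf: "g n (f n c) = c" if "c \<in> carrier (C n)" for n c
    using f[of n] that by (auto simp: g_def iso_def bij_betw_inv_into_left)
  have d': "d' n \<in> hom (C' n) (C' (n - 1))" for n
    by (rule hom_transport[where f = "f n" and p = "f (n - 1)" and h = "d n"])
      (use f d C sq in \<open>auto simp: iso_def\<close>)
  have sq': "g (n - 1) (d' n y) = d n (g n y)" if y: "y \<in> carrier (C' n)" for n y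
  proof -
    obtain c where "c \<in> carrier (C n)" "y = f n c"
      using f[of n] y by (force simp: iso_def bij_betw_def)
    then show ?thesis
      using sq gf hom_in_carrier[OF d] by simp
  qed
  show ?thesis
    unfolding cohomology_coeff_def
  proof (rule cohomology_iso[where f = "\<lambda>n \<phi>. compose (carrier (C' n)) \<phi> (g n)"])
    fix n
    show "group (hom_group (C n) A)" "group (hom_group (C' n) A)"
      by (intro group_hom_group A group.is_monoid C C')+
    show "(\<lambda>\<phi>. compose (carrier (C' n)) \<phi> (g n)) \<in> iso (hom_group (C n) A) (hom_group (C' n) A)"
      by (intro hom_group_iso g C' C group.is_monoid)
    show "(\<lambda>\<phi>. compose (carrier (C (n + 1))) \<phi> (d (n + 1))) \<in>
        carrier (hom_group (C n) A) \<rightarrow> carrier (hom_group (C (n + 1)) A)"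
      by (intro funcsetI hom_group_compose_closed[OF _ _ group.is_monoid[OF C]])
        (use d[of "n + 1"] in simp_all)
    fix \<phi>
    \<comment> \<open>These memberships let the restricted functions inside \<open>compose\<close>
      be evaluated; outside the carrier both sides are \<open>undefined\<close>.\<close>
    have "d' (n + 1) y \<in> carrier (C' n)" "g (n + 1) y \<in> carrier (C (n + 1))"
      if "y \<in> carrier (C' (n + 1))" for y
      using hom_in_carrier[OF d'[of "n + 1"] that] g[of "n + 1"] that by (auto simp: iso_def hom_def)
    then show "compose (carrier (C' (n + 1))) (compose (carrier (C' n)) \<phi> (g n)) (d' (n + 1)) =
        compose (carrier (C' (n + 1))) (compose (carrier (C (n + 1))) \<phi> (d (n + 1))) (g (n + 1))"
      using sq'[of _ "n + 1"] by (auto simp: compose_def fun_eq_iff)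
  qed
qed

section \<open>Faces of shadow biquandle chains\<close>

lemma subgroup_free_diff:
  assumes "subgroup N (free_Abelian_group S)" "x \<in> N" "y \<in> N"
  shows "x - y \<in> N"
  using subgroup.m_closed[OF assms(1,2) subgroup.m_inv_closed[OF assms(1,3)]]
    subgroup.mem_carrier[OF assms(1,3)]
  by simp

text \<open>Integer multiples are integer powers in this group, so a subgroup contains them; for an
  infinite index set the sum is \<open>0\<close>, the identity.\<close>

lemma subgroup_free_linear_combination:
  assumes N: "subgroup N (free_Abelian_group S)" and "\<And>i. i \<in> I \<Longrightarrow> f i \<in> N"
  shows "(\<Sum>i\<in>I. frag_cmul (k i) (f i)) \<in> N"
proof -
  have "frag_cmul m x \<in> N" if "x \<in> N" for m x
    using group.subgroup_int_pow_closed[OF group_free_Abelian_group N that, of m]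
      subgroup.mem_carrier[OF N that]
    by simp
  then show ?thesis
    using assms(2) subgroup.m_closed[OF N] subgroup.one_closed[OF N]
    by (induction I rule: infinite_finite_induct) auto
qed

text \<open>Positions count from 0, so the face of the paper at \<open>i\<close> has \<open>p = i - 1\<close>.\<close>

definition face :: "('b \<Rightarrow> 'c) \<Rightarrow> ('b \<Rightarrow> 'c) \<Rightarrow> nat \<Rightarrow> 'b list \<Rightarrow> 'c list" where
  "face f g p as = map f (take p as) @ map g (drop (Suc p) as)"

lemma length_face: "p < length as \<Longrightarrow> length (face f g p as) = length as - 1"
  by (simp add: face_def)

lemma set_face:
  assumes "set as \<subseteq> S" "\<And>a. a \<in> S \<Longrightarrow> f a \<in> T" "\<And>a. a \<in> S \<Longrightarrow> g a \<in> T"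
  shows "set (face f g p as) \<subseteq> T"
  using assms set_take_subset[of p as] set_drop_subset[of "Suc p" as] by (auto simp: face_def)

lemma nth_face:
  assumes "p < length as" "Suc k < length as"
  shows "face f g p as ! k = (if k < p then f (as ! k) else g (as ! Suc k))"
  using assms by (auto simp: face_def nth_append)

text \<open>Removing an entry outside the equal pair keeps the pair adjacent, and \<open>f\<close>
  or \<open>g\<close> is applied to both members alike. The pair moves down by one place when
  \<open>p < j\<close> and stays at \<open>j\<close> otherwise.\<close>

lemma face_adjacent:
  assumes "p < length as" "Suc j < length as" "as ! j = as ! Suc j" "p \<noteq> j" "p \<noteq> Suc j"
  shows "\<exists>k. Suc k < length as - 1 \<and> face f g p as ! k = face f g p as ! Suc k"
proof (cases "p < j")
  case True
  then obtain k where "j = Suc k"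
    by (cases j) auto
  then show ?thesis
    using True assms by (intro exI[of _ k]) (auto simp: nth_face)
next
  case False
  then show ?thesis
    using assms by (intro exI[of _ j]) (auto simp: nth_face)
qed

text \<open>The two faces differ at most at place \<open>j\<close>, where one has
  \<open>f (as ! j)\<close> and the other \<open>g (as ! Suc j)\<close>.\<close>

lemma face_Suc:
  assumes "Suc j < length as" "as ! j = as ! Suc j" "f (as ! j) = g (as ! j)"
  shows "face f g (Suc j) as = face f g j as"
proof -
  have "drop (Suc j) as = as ! j # drop (Suc (Suc j)) as"
    using Cons_nth_drop_Suc[OF assms(1)] assms(2) by simp
  then show ?thesis
    using assms by (simp add: face_def take_Suc_conv_app_nth)
qed

section \<open>The shadow boundary as a signed sum of faces\<close>

lemma mem_sb_basis:
  "(x, as) \<in> sb_basis B X n \<longleftrightarrow> x \<in> X \<and> set as \<subseteq> B \<and> int (length as) = n \<and> 1 \<le> n"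
  by (simp add: sb_basis_def)

definition sb_faces ::
    "('b \<Rightarrow> 'b \<Rightarrow> 'b) \<Rightarrow> ('b \<Rightarrow> 'b \<Rightarrow> 'b) \<Rightarrow> ('x \<Rightarrow> 'b \<Rightarrow> 'x) \<Rightarrow> 'x \<Rightarrow> 'b list \<Rightarrow> nat \<Rightarrow>
     ('x \<times> 'b list \<Rightarrow>\<^sub>0 int)" where
  "sb_faces under_op over_op act x as p =
     frag_of (x, face id id p as) -
     frag_of (act x (as ! p), face (\<lambda>a. under_op a (as ! p)) (\<lambda>a. over_op a (as ! p)) p as)"

text \<open>Shifting the index to \<open>p = i - 1\<close> turns the sign into
  \<open>(-1) ^ Suc p\<close>. The chain argument is dropped so that facts about
  \<open>frag_extend\<close> apply directly.\<close>

lemma sb_boundary_eq: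
  assumes "n \<ge> 2"
  shows "sb_boundary under_op over_op act n =
    frag_extend (\<lambda>(x, as). \<Sum>p<length as. frag_cmul ((-1) ^ Suc p) (sb_faces under_op over_op act x as p))"
proof -
  have "(\<Sum>i = 1..length as. frag_cmul ((-1) ^ i)
          (frag_of (x, take (i - 1) as @ drop i as) -
           frag_of (act x (as ! (i - 1)),
             map (\<lambda>a. under_op a (as ! (i - 1))) (take (i - 1) as) @
             map (\<lambda>a. over_op a (as ! (i - 1))) (drop i as)))) =
      (\<Sum>p<length as. frag_cmul ((-1) ^ Suc p) (sb_faces under_op over_op act x as p))" for x as
    unfolding sb_faces_def face_def
    by (rule sum.reindex_bij_witness[of _ Suc "\<lambda>i. i - 1"]) auto
  then show ?thesis
    using assms by (simp add: sb_boundary_def fun_eq_iff)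
qed

section \<open>The boundary preserves degenerate chains\<close>

context shadow_biquandle
begin

text \<open>The bound \<open>n \<ge> 2\<close> keeps the degree of the faces at least 1, below which
  the basis is empty.\<close>

lemma face_closed:
  assumes "(x, as) \<in> sb_basis B X n" "n \<ge> 2" "p < length as"
  shows "(x, face id id p as) \<in> sb_basis B X (n - 1)"
    and "(x \<diamondop> as ! p, face (\<lambda>a. a \<triangleleft> as ! p) (\<lambda>a. a \<triangleright> as ! p) p as) \<in> sb_basis B X (n - 1)"
proof -
  have "as ! p \<in> B"
    using assms nth_mem by (fastforce simp: mem_sb_basis)
  then show "(x, face id id p as) \<in> sb_basis B X (n - 1)"
    "(x \<diamondop> as ! p, face (\<lambda>a. a \<triangleleft> as ! p) (\<lambda>a. a \<triangleright> as ! p) p as) \<in> sb_basis B X (n - 1)"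
    using assms set_face[of as B id B id p]
      set_face[of as B "\<lambda>a. a \<triangleleft> as ! p" B "\<lambda>a. a \<triangleright> as ! p" p]
    by (auto simp: mem_sb_basis length_face act_closed under_closed over_closed)
qed

lemma sb_boundary_hom:
  "sb_boundary (\<triangleleft>) (\<triangleright>) (\<diamondop>) n \<in> hom (sb_chain B X n) (sb_chain B X (n - 1))"
proof (cases "n \<ge> 2")
  case True
  \<comment> \<open>The whole group is taken as a subgroup of itself, so that the closure lemmas
    above apply to the sum of faces.\<close>
  note N = group.subgroup_self[OF group_free_Abelian_group, of "sb_basis B X (n - 1)"]
  have "(\<Sum>p<length as. frag_cmul ((-1) ^ Suc p) (sb_faces (\<triangleleft>) (\<triangleright>) (\<diamondop>) x as p))
      \<in> carrier (free_Abelian_group (sb_basis B X (n - 1)))"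
    if "(x, as) \<in> sb_basis B X n" for x as
    using face_closed[OF that True] unfolding sb_faces_def
    by (intro subgroup_free_linear_combination[OF N] subgroup_free_diff[OF N]) auto
  then show ?thesis
    unfolding sb_boundary_eq[OF True] sb_chain_def by (intro frag_extend_hom) auto
next
  case False
  then show ?thesis
    by (auto simp: sb_boundary_def sb_chain_def hom_def)
qed

lemma subgroup_sb_degenerate: "subgroup (sb_degenerate B X n) (sb_chain B X n)"
  unfolding sb_degenerate_def sb_chain_def by (rule group.generate_is_subgroup) auto

lemma frag_of_sb_degenerate:
  assumes "(x, as) \<in> sb_basis B X n" "Suc k < length as" "as ! k = as ! Suc k"
  shows "frag_of (x, as) \<in> sb_degenerate B X n"
  unfolding sb_degenerate_def
  \<comment> \<open>The definition names an equal pair by the position of its second entry, hence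
    \<open>Suc k\<close>.\<close>
  using assms by (intro generate.incl imageI) (auto intro!: exI[of _ "Suc k"])

text \<open>The faces at \<open>j\<close> and \<open>Suc j\<close> agree and carry opposite signs,
  so they cancel; every other face keeps an equal adjacent pair and is itself degenerate.\<close>

lemma sb_boundary_degenerate_generator:
  assumes as: "(x, as) \<in> sb_basis B X n" and j: "Suc j < length as" "as ! j = as ! Suc j"
  shows "sb_boundary (\<triangleleft>) (\<triangleright>) (\<diamondop>) n (frag_of (x, as)) \<in> sb_degenerate B X (n - 1)"
proof -
  have n: "n \<ge> 2"
    using as j by (simp add: mem_sb_basis)
  define F where "F = sb_faces (\<triangleleft>) (\<triangleright>) (\<diamondop>) x as"
  note N = subgroup_sb_degenerate[unfolded sb_chain_def]
  have "as ! j \<in> B"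
    using as j nth_mem by (fastforce simp: mem_sb_basis)
  \<comment> \<open>For the second terms of the two faces this is the axiom \<open>a \<triangleleft> a = a \<triangleright> a\<close>.\<close>
  then have cancel: "F (Suc j) = F j"
    using j by (simp add: F_def sb_faces_def face_Suc diag)
  have F: "F p \<in> sb_degenerate B X (n - 1)" if "p < length as" "p \<noteq> j" "p \<noteq> Suc j" for p
  proof -
    \<comment> \<open>Leaving \<open>y\<close>, \<open>f\<close> and \<open>g\<close> open treats
      both terms of \<open>F p\<close> at once.\<close>
    have "frag_of (y, face f g p as) \<in> sb_degenerate B X (n - 1)"
      if "(y, face f g p as) \<in> sb_basis B X (n - 1)" for y and f g :: "'b \<Rightarrow> 'b"
      using face_adjacent[OF \<open>p < length as\<close> j \<open>p \<noteq> j\<close> \<open>p \<noteq> Suc j\<close>, of f g]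
        frag_of_sb_degenerate[OF that] length_face[OF \<open>p < length as\<close>, of f g]
      by auto
    then show ?thesis
      unfolding F_def sb_faces_def
      using face_closed[OF as n \<open>p < length as\<close>] by (intro subgroup_free_diff[OF N])
  qed
  have "sb_boundary (\<triangleleft>) (\<triangleright>) (\<diamondop>) n (frag_of (x, as)) = (\<Sum>p<length as. frag_cmul ((-1) ^ Suc p) (F p))"
    by (simp add: sb_boundary_eq[OF n] F_def)
  also have "\<dots> = (\<Sum>p\<in>{..<length as} - {j, Suc j}. frag_cmul ((-1) ^ Suc p) (F p)) +
      (\<Sum>p\<in>{j, Suc j}. frag_cmul ((-1) ^ Suc p) (F p))"
    using j by (intro sum.subset_diff) auto
  also have "(\<Sum>p\<in>{j, Suc j}. frag_cmul ((-1) ^ Suc p) (F p)) = 0"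
    using cancel by (simp flip: frag_cmul_distrib)
  finally show ?thesis
    using F by (auto intro!: subgroup_free_linear_combination[OF N])
qed

text \<open>As the boundary is a homomorphism, it suffices to know where the generators go.\<close>

lemma sb_boundary_degenerate:
  "sb_boundary (\<triangleleft>) (\<triangleright>) (\<diamondop>) n ` sb_degenerate B X n \<subseteq> sb_degenerate B X (n - 1)"
proof -
  let ?S = "frag_of ` {(x, as) \<in> sb_basis B X n.
      \<exists>i. 1 \<le> i \<and> i \<le> length as - 1 \<and> as ! (i - 1) = as ! i}"
  have "sb_boundary (\<triangleleft>) (\<triangleright>) (\<diamondop>) n ` ?S \<subseteq> sb_degenerate B X (n - 1)"
  proof clarify
    fix x as i
    assume "(x, as) \<in> sb_basis B X n" "1 \<le> i" "i \<le> length as - 1" "as ! (i - 1) = as ! i"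
    then show "sb_boundary (\<triangleleft>) (\<triangleright>) (\<diamondop>) n (frag_of (x, as)) \<in> sb_degenerate B X (n - 1)"
      by (intro sb_boundary_degenerate_generator[of x as n "i - 1"]) auto
  qed
  moreover have "?S \<subseteq> carrier (sb_chain B X n)"
    by (auto simp: sb_chain_def)
  ultimately show ?thesis
    unfolding sb_degenerate_def[of B X n]
    using generate_hom_image[OF _ _ sb_boundary_hom]
      group.generate_subgroup_incl[OF _ _ subgroup_sb_degenerate]
    by (simp add: sb_chain_def)
qed

section \<open>Comparison with the local biquandle complex\<close>

definition to_local :: "'x \<times> 'b list \<Rightarrow> ('x \<times> 'x) list" where
  "to_local = (\<lambda>(x, as). map (\<lambda>a. (x, x \<diamondop> a)) as)"

abbreviation chain_to_local :: "('x \<times> 'b list \<Rightarrow>\<^sub>0 int) \<Rightarrow> (('x \<times> 'x) list \<Rightarrow>\<^sub>0 int)" where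
  "chain_to_local \<equiv> frag_extend (\<lambda>s. frag_of (to_local s))"

context
  assumes sc: "strongly_connected B X (\<diamondop>)"
begin

abbreviation bracket :: "'x \<Rightarrow> 'x \<Rightarrow> 'x \<Rightarrow> 'x" where
  "bracket \<equiv> shadow_tribracket B (\<triangleright>) (\<diamondop>)"

lemma connector_closed:
  assumes "x \<in> X" "y \<in> X"
  shows "connector B (\<diamondop>) x y \<in> B" "x \<diamondop> connector B (\<diamondop>) x y = y"
  using ex_connector[OF sc assms] connector_act[OF sc assms(1)] by auto

text \<open>Degrees start at 1, so the lists are nonempty and the common first component
  \<open>x\<close> can be read off the head; \<open>connector\<close> then recovers each
  \<open>a\<close> from \<open>x\<close> and \<open>x \<diamondop> a\<close>.\<close>

lemma to_local_bij: "bij_betw to_local (sb_basis B X n) (lb_basis X n)"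
proof (rule bij_betw_byWitness[where
      f' = "\<lambda>ps. (fst (hd ps), map (\<lambda>p. connector B (\<diamondop>) (fst p) (snd p)) ps)"])
  show "to_local ` sb_basis B X n \<subseteq> lb_basis X n"
    by (fastforce simp: to_local_def sb_basis_def lb_basis_def act_closed subset_iff)
  have ps: "\<exists>x\<in>X. fst (hd ps) = x \<and> (\<forall>p\<in>set ps. fst p = x \<and> snd p \<in> X) \<and> int (length ps) = n \<and> n \<ge> 1"
    if "ps \<in> lb_basis X n" for ps
    using that by (cases ps) (auto simp: lb_basis_def)
  show "(\<lambda>ps. (fst (hd ps), map (\<lambda>p. connector B (\<diamondop>) (fst p) (snd p)) ps)) ` lb_basis X n \<subseteq> sb_basis B X n"
    using ps by (force simp: sb_basis_def connector_closed)
  show "\<forall>ps\<in>lb_basis X n.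
      to_local (fst (hd ps), map (\<lambda>p. connector B (\<diamondop>) (fst p) (snd p)) ps) = ps"
    using ps by (fastforce simp: to_local_def connector_closed prod_eq_iff intro: map_idI)
  show "\<forall>s\<in>sb_basis B X n. (fst (hd (to_local s)),
      map (\<lambda>p. connector B (\<diamondop>) (fst p) (snd p)) (to_local s)) = s"
  proof
    fix s
    assume "s \<in> sb_basis B X n"
    then obtain x as where "s = (x, as)" "x \<in> X" "set as \<subseteq> B" "as \<noteq> []"
      by (fastforce simp: sb_basis_def)
    then show "(fst (hd (to_local s)),
        map (\<lambda>p. connector B (\<diamondop>) (fst p) (snd p)) (to_local s)) = s"
      using connector_act[OF sc] by (auto simp: to_local_def hd_map intro!: map_idI)
  qed
qed

lemma chain_to_local_iso: "chain_to_local \<in> iso (sb_chain B X n) (lb_chain X n)"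
  unfolding sb_chain_def lb_chain_def by (rule frag_extend_iso[OF to_local_bij])

text \<open>Put \<open>b = as ! p\<close>. In the second face all pairs have first component
  \<open>x \<diamondop> b\<close>. An entry \<open>a\<close> before position \<open>p\<close> needs
  the bracket of \<open>x\<close>, \<open>x \<diamondop> a\<close>, \<open>x \<diamondop> b\<close>
  as \<open>(x \<diamondop> b) \<diamondop> (a \<triangleleft> b)\<close>; one after it needs the
  bracket of \<open>x\<close>, \<open>x \<diamondop> b\<close>, \<open>x \<diamondop> a\<close> as
  \<open>(x \<diamondop> b) \<diamondop> (a \<triangleright> b)\<close>. These are the two
  expressions for the bracket.\<close>

lemma chain_to_local_faces:
  assumes as: "(x, as) \<in> sb_basis B X n" and p: "p < length as"
  defines "ps \<equiv> to_local (x, as)"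
  shows "chain_to_local (sb_faces (\<triangleleft>) (\<triangleright>) (\<diamondop>) x as p) =
    frag_of (face id id p ps) -
    frag_of (face (\<lambda>q. local_under bracket q (ps ! p)) (\<lambda>q. local_over bracket q (ps ! p)) p ps)"
proof -
  have x: "x \<in> X" and B: "set as \<subseteq> B"
    using as by (auto simp: mem_sb_basis)
  have a: "a \<in> B" if "a \<in> set (take p as) \<or> a \<in> set (drop (Suc p) as)" for a
    using that B by (auto dest: in_set_takeD in_set_dropD)
  have pB: "as ! p \<in> B"
    using B p by auto
  have "to_local (x \<diamondop> as ! p, face (\<lambda>a. a \<triangleleft> as ! p) (\<lambda>a. a \<triangleright> as ! p) p as) =
      face (\<lambda>q. local_under bracket q (ps ! p)) (\<lambda>q. local_over bracket q (ps ! p)) p ps"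
    using a p
    by (auto simp: ps_def to_local_def face_def take_map drop_map local_under_def local_over_def
        shadow_tribracket_act[OF sc x pB] shadow_tribracket_act'[OF sc x _ pB])
  moreover have "to_local (x, face id id p as) = face id id p ps"
    by (simp add: ps_def to_local_def face_def take_map drop_map)
  ultimately show ?thesis
    by (simp add: sb_faces_def frag_extend_diff)
qed

text \<open>Both sides extend functions on the basis linearly, so they are compared on basis
  elements, where they agree summand by summand. Below degree 2 both are \<open>0\<close>.\<close>

lemma chain_to_local_boundary:
  assumes "c \<in> carrier (sb_chain B X n)"
  shows "lb_boundary bracket n (chain_to_local c) =
    chain_to_local (sb_boundary (\<triangleleft>) (\<triangleright>) (\<diamondop>) n c)"
proof (cases "n \<ge> 2")
  case True
  have "(\<Sum>i = 1..length ps. frag_cmul ((-1) ^ i)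
          (frag_of (take (i - 1) ps @ drop i ps) -
           frag_of
            (map (\<lambda>q. local_under bracket q (ps ! (i - 1))) (take (i - 1) ps) @
             map (\<lambda>q. local_over bracket q (ps ! (i - 1))) (drop i ps)))) =
      chain_to_local (\<Sum>p<length as. frag_cmul ((-1) ^ Suc p) (sb_faces (\<triangleleft>) (\<triangleright>) (\<diamondop>) x as p))"
    (is "?l = ?r") if as: "(x, as) \<in> sb_basis B X n" and ps: "ps = to_local (x, as)" for x as ps
  proof -
    have "length ps = length as"
      by (simp add: ps to_local_def)
    then have "?l = (\<Sum>p<length as. frag_cmul ((-1) ^ Suc p) (frag_of (face id id p ps) -
        frag_of (face (\<lambda>q. local_under bracket q (ps ! p)) (\<lambda>q. local_over bracket q (ps ! p)) p ps)))"
      unfolding face_def by (intro sum.reindex_bij_witness[of _ Suc "\<lambda>i. i - 1"]) auto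
    then show ?thesis
      using chain_to_local_faces[OF as] by (simp add: ps frag_extend_sum frag_extend_cmul del: power_Suc)
  qed
  then show ?thesis
    using assms True unfolding lb_boundary_def sb_boundary_eq[OF True]
    by (auto simp: frag_extend_extend sb_chain_def intro!: frag_extend_eq)
qed (simp add: lb_boundary_def sb_boundary_def)

text \<open>Since \<open>a \<mapsto> x \<diamondop> a\<close> is injective on \<open>B\<close>,
  adjacent entries of a tuple are equal exactly when their images are. Hence the generators
  correspond, and so do the subgroups they generate.\<close>

lemma chain_to_local_degenerate: "chain_to_local ` sb_degenerate B X n = lb_degenerate X n"
proof -
  let ?S = "{(x, as) \<in> sb_basis B X n. \<exists>i. 1 \<le> i \<and> i \<le> length as - 1 \<and> as ! (i - 1) = as ! i}"
  let ?T = "{ps \<in> lb_basis X n. \<exists>i. 1 \<le> i \<and> i \<le> length ps - 1 \<and> ps ! (i - 1) = ps ! i}"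
  have adj: "(to_local (x, as) ! (i - 1) = to_local (x, as) ! i) = (as ! (i - 1) = as ! i)"
    if as: "(x, as) \<in> sb_basis B X n" and i: "1 \<le> i" "i \<le> length as - 1" for x as i
  proof -
    have "as ! (i - 1) \<in> B" "as ! i \<in> B" "x \<in> X" "i - 1 < length as" "i < length as"
      using as i by (auto simp: mem_sb_basis)
    then show ?thesis
      using act_cancel[OF sc] by (auto simp: to_local_def)
  qed
  have len: "length (to_local (x, as)) = length as" for x as
    by (simp add: to_local_def)
  have "to_local ` ?S = ?T"
  proof
    show "to_local ` ?S \<subseteq> ?T"
    proof clarify
      fix x as i
      assume "(x, as) \<in> sb_basis B X n" "1 \<le> i" "i \<le> length as - 1" "as ! (i - 1) = as ! i"
      then show "to_local (x, as) \<in> lb_basis X n \<and>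
          (\<exists>i\<ge>1. i \<le> length (to_local (x, as)) - 1 \<and> to_local (x, as) ! (i - 1) = to_local (x, as) ! i)"
        using adj[of x as i] len[of x as] bij_betwE[OF to_local_bij[of n]] by auto
    qed
    show "?T \<subseteq> to_local ` ?S"
    proof clarify
      fix ps i
      assume "ps \<in> lb_basis X n" and i: "1 \<le> i" "i \<le> length ps - 1" "ps ! (i - 1) = ps ! i"
      then obtain x as where as: "(x, as) \<in> sb_basis B X n" and ps: "ps = to_local (x, as)"
        using to_local_bij[of n] by (force simp: bij_betw_def)
      then have "(x, as) \<in> ?S"
        using adj[OF as] i len by (auto intro!: exI[of _ i])
      then show "ps \<in> to_local ` ?S"
        using ps by (rule rev_image_eqI)
    qed
  qed
  then have "chain_to_local ` frag_of ` ?S = frag_of ` ?T"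
    unfolding image_image frag_extend_of by (simp only: image_image[symmetric, of frag_of to_local])
  moreover have "frag_of ` ?S \<subseteq> carrier (sb_chain B X n)"
    by (auto simp: sb_chain_def)
  moreover have "chain_to_local \<in> hom (sb_chain B X n) (lb_chain X n)"
    using chain_to_local_iso by (simp add: iso_def)
  ultimately show ?thesis
    unfolding sb_degenerate_def lb_degenerate_def
    by (subst generate_hom_image[where H = "lb_chain X n"]) (simp_all add: sb_chain_def lb_chain_def)
qed

section \<open>Passage to the quotients by degenerate chains\<close>

lemma group_SB_chain: "group (SB_chain B X n)"
  and group_LB_chain: "group (LB_chain X n)"
proof -
  have "subgroup (lb_degenerate X n) (lb_chain X n)"
    unfolding lb_degenerate_def lb_chain_def by (rule group.generate_is_subgroup) auto
  then show "group (SB_chain B X n)" "group (LB_chain X n)"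
    using subgroup_sb_degenerate[of n]
    by (simp_all add: SB_chain_def LB_chain_def sb_chain_def lb_chain_def comm_group.axioms(2)
        comm_group.abelian_FactGroup abelian_free_Abelian_group)
qed

lemma SB_chain_iso: "(`) chain_to_local \<in> iso (SB_chain B X n) (LB_chain X n)"
  using Mod_iso[OF _ chain_to_local_iso subgroup.subset[OF subgroup_sb_degenerate]]
  by (simp add: SB_chain_def LB_chain_def chain_to_local_degenerate sb_chain_def)

lemma SB_boundary_hom:
  "SB_boundary B (\<triangleleft>) (\<triangleright>) X (\<diamondop>) n \<in> hom (SB_chain B X n) (SB_chain B X (n - 1))"
  unfolding SB_boundary_def SB_chain_def
  using subgroup_sb_degenerate sb_boundary_hom sb_boundary_degenerate
  by (intro induced_map_hom comm_group.subgroup_imp_normal)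
    (simp_all add: sb_chain_def abelian_free_Abelian_group)

lemma LB_boundary_transport:
  assumes "K \<in> carrier (SB_chain B X n)"
  shows "LB_boundary X bracket n (chain_to_local ` K) =
    chain_to_local ` SB_boundary B (\<triangleleft>) (\<triangleright>) X (\<diamondop>) n K"
  \<comment> \<open>Writing the degenerate chains of the local side as an image reduces everything
    to facts about \<open>sb_boundary\<close>.\<close>
  unfolding LB_boundary_def SB_boundary_def chain_to_local_degenerate[symmetric]
  by (rule induced_map_transport[OF _ _ _ _ chain_to_local_iso chain_to_local_iso sb_boundary_hom
        chain_to_local_boundary subgroup_sb_degenerate subgroup_sb_degenerate sb_boundary_degenerate])
    (use assms in \<open>simp_all add: sb_chain_def lb_chain_def SB_chain_def\<close>)

end

end

theorem theorem4p4:
  fixes B :: "'b set" and under_op over_op :: "'b \<Rightarrow> 'b \<Rightarrow> 'b"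
    and X :: "'x set" and act :: "'x \<Rightarrow> 'b \<Rightarrow> 'x"
    and A :: "'a monoid" and n :: int
  assumes "shadow_biquandle B under_op over_op X act"
    and "strongly_connected B X act"
    and "comm_group A"
  shows "SB_homology B under_op over_op X act A n \<cong> LB_homology X (shadow_tribracket B over_op act) A n
       \<and> SB_cohomology B under_op over_op X act A n \<cong> LB_cohomology X (shadow_tribracket B over_op act) A n"
proof -
  interpret shadow_biquandle B under_op over_op X act
    by fact
  note iso = group_SB_chain[OF assms(2)] group_LB_chain[OF assms(2)]
    SB_chain_iso[OF assms(2)] SB_boundary_hom[OF assms(2)] LB_boundary_transport[OF assms(2)]
  have "group A"
    using assms(3) by (rule comm_group.axioms(2))
  then show ?thesis
    unfolding SB_homology_def LB_homology_def SB_cohomology_def LB_cohomology_def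
    \<comment> \<open>\<open>chain_to_local\<close> does not depend on the degree, so a constant
      family of maps serves.\<close>
    by (intro conjI homology_coeff_iso[where f = "\<lambda>_. (`) chain_to_local"]
        cohomology_coeff_iso[where f = "\<lambda>_. (`) chain_to_local"])
      (use iso assms(3) in blast)+
qed

end
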